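(* Let $m\ge3$ be an integer and define $R_m$ and $c_m$ as follows: for $m=3$, $R_3=\{0\}$, $c_3=1$; for $m=5$, $R_5=\{0,1,2,3,5,7,13,26,27,28,29,31\}$, $c_5=122$; for $m=7$, $R_7=\{0,1,2,3,4,5,7,10,33,34,35,36,37,38\}$, $c_7=219$; for $m=2n$ with $n>1$, $R_m=\{0,1,\ldots,2n\}$, $c_m=2n^2+3n-2$; for $m=2n+1$ with $n>3$, $R_m=N\cup\{3n+1\}\cup\{x+2n^2+5n: x\in N\}$ where $N=\{0,1,\ldots,2n-1\}\cup\{2n+1\}$, and $c_m=4n^3+12n^2+5n$. Then a nonnegative integer is in the sequence $S_m$ if and only if it can be expressed in the form $c_m\sum_{i\ge0}t_im^i+r$ with $t_i\in\{0,1\}$ for all $i$ (finitely many nonzero) and $r\in R_m$.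
   Context: For an integer $m\ge3$, $S_m$ is the sequence defined greedily by $a_0=0$ and, having chosen $a_0,\ldots,a_k$, $a_{k+1}$ is the least integer greater than $a_k$ such that there are no distinct $x_1,\ldots,x_m\in\{a_0,\ldots,a_{k+1}\}$ with $x_1+\cdots+x_{m-1}=(m-1)x_m$. *)

theory Defs
  imports Main
begin

definition has_mean_solution :: "nat \<Rightarrow> nat set \<Rightarrow> bool" where
  "has_mean_solution m A \<longleftrightarrow>
     (\<exists>x :: nat \<Rightarrow> nat. inj_on x {1..m} \<and> x ` {1..m} \<subseteq> A \<and>
        (\<Sum>i = 1..m - 1. x i) = (m - 1) * x m)"

text \<open>For \<open>m \<ge> 3\<close> the set under \<open>LEAST\<close> is nonempty: with \<open>M\<close> the largest earlier term,
  any \<open>b > (m - 1) * M\<close> is too large to occur in a solution together with earlier terms.\<close>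

fun S_seq :: "nat \<Rightarrow> nat \<Rightarrow> nat" where
  "S_seq m 0 = 0"
| "S_seq m (Suc k) =
     (LEAST b. S_seq m k < b \<and> \<not> has_mean_solution m (insert b (S_seq m ` {..k})))"

text \<open>In the two functions below the general cases are parametrised by \<open>n = m div 2\<close>,
  so \<open>m = 2 * n\<close> for even and \<open>m = 2 * n + 1\<close> for odd \<open>m\<close>.  Only \<open>m \<ge> 3\<close> is meaningful.\<close>

definition R_set :: "nat \<Rightarrow> nat set" where
  "R_set m =
     (if m = 3 then {0}
      else if m = 5 then {0, 1, 2, 3, 5, 7, 13, 26, 27, 28, 29, 31}
      else if m = 7 then {0, 1, 2, 3, 4, 5, 7, 10, 33, 34, 35, 36, 37, 38}
      else let n = m div 2 in
        if even m then {0..2 * n}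
        else let N = {0..2 * n - 1} \<union> {2 * n + 1} in
          N \<union> {3 * n + 1} \<union> {x + 2 * n ^ 2 + 5 * n | x. x \<in> N})"

definition c_val :: "nat \<Rightarrow> nat" where
  "c_val m =
     (if m = 3 then 1
      else if m = 5 then 122
      else if m = 7 then 219
      else let n = m div 2 in
        if even m then 2 * n ^ 2 + 3 * n - 2
        else 4 * n ^ 3 + 12 * n ^ 2 + 5 * n)"

end

theory Submission
  imports Defs "HOL-Library.Infinite_Set" "HOL-Library.Code_Binary_Nat"
begin

text \<open>Write \<open>T\<close> for the set of numbers whose base-\<open>m\<close> digits are 0 or 1.  The greedy sequence
  enumerates \<open>c T + R\<close> as soon as this set has no mean solution and every number outside it is
  forced into a mean solution with smaller members.

  A mean solution in \<open>c T + R\<close> gives, on the quotients modulo \<open>c\<close>, an equation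
  \<open>t\<^sub>1 + \<dots> + t\<^sub>m = m t\<^sub>m + k\<close>, where \<open>k \<in> {-1, 0, 1}\<close> by the size of \<open>R\<close>.  Comparing lowest digits
  modulo \<open>m\<close> shows that all \<open>t\<^sub>i\<close> agree if \<open>k = 0\<close>, and all but one agree apart from \<open>t\<^sub>m\<close>
  otherwise.  So \<open>m\<close>, respectively at least \<open>m - 2\<close>, of the residues are distinct elements of \<open>R\<close>:
  the first case is excluded since \<open>R\<close> has no mean solution, the second since \<open>m - 2\<close> distinct
  residues leave no room for a difference of \<open>c\<close>.

  Conversely, a number \<open>q\<close> with a digit \<open>\<ge> 2\<close> is an affine combination \<open>(m - 1) t - \<Sum> z\<^sub>i\<close> of elements
  of \<open>T\<close> smaller than \<open>q\<close>, found digit by digit, and the residues are handled by a combination of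
  the same shape inside \<open>R\<close>.  What remains is a finite analysis of \<open>R\<close>: by hand for the two
  families, by a subset sum search for \<open>m \<in> {3, 5, 7}\<close>.\<close>

section \<open>Mean solutions as sets\<close>

text \<open>The equation is symmetric in the first m - 1 unknowns, so a solution amounts to the mean
  \<open>y\<close> and the set \<open>W\<close> of the others; sums over sets are easier to bound
  than sums over tuples.\<close>

lemma has_mean_solution_iff:
  assumes "m \<ge> 1"
  shows "has_mean_solution m A \<longleftrightarrow>
    (\<exists>y W. y \<in> A \<and> W \<subseteq> A \<and> finite W \<and> y \<notin> W \<and> card W = m - 1 \<and> \<Sum>W = (m - 1) * y)"
proof
  assume "has_mean_solution m A"
  then obtain x :: "nat \<Rightarrow> nat" where x: "inj_on x {1..m}" "x ` {1..m} \<subseteq> A"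
    "(\<Sum>i = 1..m - 1. x i) = (m - 1) * x m"
    unfolding has_mean_solution_def by blast
  define W where "W = x ` {1..m - 1}"
  have inj: "inj_on x {1..m - 1}"
    using x(1) by (rule inj_on_subset) auto
  have "x m \<notin> W"
  proof
    assume "x m \<in> W"
    then obtain i where i: "i \<in> {1..m - 1}" "x m = x i" unfolding W_def by blast
    then have "m = i" using inj_onD[OF x(1), of m i] assms by auto
    then show False using i(1) assms by simp
  qed
  moreover have "card W = m - 1" "\<Sum>W = (m - 1) * x m"
    using inj x(3) by (simp_all add: W_def card_image sum.reindex)
  moreover have "x m \<in> A" "W \<subseteq> A"
    using x(2) assms unfolding W_def by fastforce+
  ultimately show "\<exists>y W. y \<in> A \<and> W \<subseteq> A \<and> finite W \<and> y \<notin> W \<and> card W = m - 1 \<and> \<Sum>W = (m - 1) * y"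
    unfolding W_def by blast
next
  assume "\<exists>y W. y \<in> A \<and> W \<subseteq> A \<and> finite W \<and> y \<notin> W \<and> card W = m - 1 \<and> \<Sum>W = (m - 1) * y"
  then obtain y W where y: "y \<in> A" "W \<subseteq> A" "finite W" "y \<notin> W" "card W = m - 1"
    "\<Sum>W = (m - 1) * y"
    by blast
  obtain f where f: "bij_betw f {1..m - 1} W"
    using y(3,5) ex_bij_betw_nat_finite_1 by metis
  define x where "x = f(m := y)"
  have split: "{1..m} = insert m {1..m - 1}"
    using assms by auto
  have xf: "x i = f i" if "i \<in> {1..m - 1}" for i
    using that assms unfolding x_def by (cases "i = m") auto
  then have img: "x ` {1..m - 1} = W"
    using f unfolding bij_betw_def by (metis image_cong)
  have "inj_on x {1..m - 1}"
    using f xf unfolding bij_betw_def by (metis inj_on_cong)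
  then have "inj_on x {1..m}"
    unfolding split using img y(4) by (auto simp: x_def)
  moreover have "x ` {1..m} \<subseteq> A"
    unfolding split using img y(1,2) by (auto simp: x_def)
  moreover have "(\<Sum>i = 1..m - 1. x i) = \<Sum>W"
    using \<open>inj_on x {1..m - 1}\<close> img by (metis sum.reindex_cong)
  ultimately show "has_mean_solution m A"
    using y(6) unfolding has_mean_solution_def by (intro exI[of _ x]) (simp add: x_def)
qed

text \<open>A number can be the mean only of numbers some of which are larger, so the new term \<open>b\<close> of a
  greedy step is never the mean \<open>x\<^sub>m\<close>.\<close>

definition blocked :: "nat \<Rightarrow> nat set \<Rightarrow> nat \<Rightarrow> bool" where
  "blocked m A b \<longleftrightarrow> (\<exists>y W. y \<in> A \<and> y < b \<and> W \<subseteq> A \<and> W \<subseteq> {..<b} \<and> y \<notin> W \<and>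
     card W = m - 2 \<and> b + \<Sum>W = (m - 1) * y)"

lemma blockedI:
  assumes "y \<in> A" "y < b" "W \<subseteq> A" "W \<subseteq> {..<b}" "y \<notin> W" "card W = m - 2" "b + \<Sum>W = (m - 1) * y"
  shows "blocked m A b"
  using assms unfolding blocked_def by blast

lemma blocked_has_mean_solution:
  assumes "m \<ge> 2" "blocked m A b"
  shows "has_mean_solution m (insert b {a \<in> A. a < b})"
proof -
  obtain y W where y: "y \<in> A" "y < b" "W \<subseteq> A" "W \<subseteq> {..<b}" "y \<notin> W" "card W = m - 2"
    "b + \<Sum>W = (m - 1) * y"
    using assms(2) unfolding blocked_def by blast
  have fin: "finite W" using y(4) finite_subset by blast
  have "b \<notin> W" using y(4) by blast
  then have "card (insert b W) = m - 1" "\<Sum>(insert b W) = (m - 1) * y"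
    using fin y assms(1) by auto
  moreover have "y \<notin> insert b W" using y by auto
  moreover have "insert b W \<subseteq> insert b {a \<in> A. a < b}" "y \<in> insert b {a \<in> A. a < b}"
    using y by auto
  ultimately show ?thesis
    using has_mean_solution_iff[of m] assms(1) fin by (meson finite_insert order_trans one_le_numeral)
qed

section \<open>The greedy sequence\<close>

lemma has_mean_solution_mono:
  "has_mean_solution m A \<Longrightarrow> A \<subseteq> B \<Longrightarrow> has_mean_solution m B"
  unfolding has_mean_solution_def by blast

text \<open>By \<open>free\<close> the greedy step never rejects an element of \<open>A\<close>, and
  by \<open>fill\<close> it rejects every number outside. So the terms chosen so far always form an
  initial segment of \<open>A\<close>.\<close>

lemma range_S_seq_eq:
  assumes zero: "0 \<in> A" and inf: "infinite A" and free: "\<not> has_mean_solution m A"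
    and fill: "\<And>b. b \<notin> A \<Longrightarrow> has_mean_solution m (insert b {a \<in> A. a < b})"
  shows "range (S_seq m) = A"
proof -
  \<comment> \<open>The bound \<open>k \<le> S_seq m k\<close> shows in the end that each element a
    of \<open>A\<close> occurs among the terms with index at most a.\<close>
  have inv: "S_seq m k \<in> A \<and> S_seq m ` {..k} = {a \<in> A. a \<le> S_seq m k} \<and> k \<le> S_seq m k" for k
  proof (induction k)
    case 0
    then show ?case using zero by auto
  next
    case (Suc k)
    let ?s = "S_seq m k"
    define a where "a = (LEAST a. a \<in> A \<and> ?s < a)"
    have ex: "\<exists>a. a \<in> A \<and> ?s < a"
      using inf by (meson infinite_nat_iff_unbounded)
    have a: "a \<in> A" "?s < a"
      using LeastI_ex[OF ex] unfolding a_def by auto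
    have between: "b \<notin> A" if "?s < b" "b < a" for b
      using that not_less_Least unfolding a_def by blast
    have below: "{x \<in> A. x < b} = S_seq m ` {..k}" if "?s < b" "b \<le> a" for b
    proof -
      have "x < b \<longleftrightarrow> x \<le> ?s" if "x \<in> A" for x
      proof
        assume "x < b"
        then show "x \<le> ?s" using between[of x] \<open>x \<in> A\<close> \<open>b \<le> a\<close> by (meson not_le order_less_le_trans)
      qed (use \<open>?s < b\<close> in simp)
      then show ?thesis using Suc by blast
    qed
    have "S_seq m (Suc k) = a"
      unfolding S_seq.simps
    proof (rule Least_equality)
      have "insert a (S_seq m ` {..k}) \<subseteq> A"
        using a Suc by auto
      then show "?s < a \<and> \<not> has_mean_solution m (insert a (S_seq m ` {..k}))"
        using a free has_mean_solution_mono by blast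
    next
      fix b
      assume b: "?s < b \<and> \<not> has_mean_solution m (insert b (S_seq m ` {..k}))"
      show "a \<le> b"
      proof (rule ccontr)
        assume "\<not> a \<le> b"
        then show False
          using b fill[of b] between[of b] below[of b] by auto
      qed
    qed
    moreover have "{x \<in> A. x \<le> a} = insert a {x \<in> A. x < a}"
      using a(1) by auto
    then have "{x \<in> A. x \<le> a} = insert a (S_seq m ` {..k})"
      using below[of a] a(2) by simp
    ultimately show ?case
      using a Suc by (auto simp: atMost_Suc)
  qed
  show ?thesis
  proof
    show "range (S_seq m) \<subseteq> A" using inv by blast
    show "A \<subseteq> range (S_seq m)"
    proof
      fix a assume "a \<in> A"
      then have "a \<in> S_seq m ` {..a}" using inv[of a] by auto
      then show "a \<in> range (S_seq m)" by blast
    qed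
  qed
qed

section \<open>Numbers with digits 0 and 1\<close>

definition zero_one :: "nat \<Rightarrow> nat set" where
  "zero_one m = {\<Sum>i\<in>I. m ^ i | I. finite I}"

lemma zero_one_0: "0 \<in> zero_one m"
  unfolding zero_one_def by (rule CollectI, rule exI[of _ "{}"]) simp

lemma sum_power_Suc_image: "(\<Sum>i\<in>Suc ` I. m ^ i) = m * (\<Sum>i\<in>I. (m::nat) ^ i)"
  by (simp add: sum.reindex sum_distrib_left)

lemma zero_one_shift: "t \<in> zero_one m \<Longrightarrow> m * t \<in> zero_one m"
  unfolding zero_one_def using sum_power_Suc_image by (smt (verit) finite_imageI mem_Collect_eq)

lemma zero_one_shift1: 
  assumes "t \<in> zero_one m"
  shows "m * t + 1 \<in> zero_one m"
proof -
  obtain I where I: "finite I" "t = (\<Sum>i\<in>I. m ^ i)"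
    using assms unfolding zero_one_def by blast
  have "(\<Sum>i\<in>insert 0 (Suc ` I). m ^ i) = m * t + 1"
    using I by (simp add: sum_power_Suc_image)
  then show ?thesis
    unfolding zero_one_def using I(1) by (metis (mono_tags, lifting) CollectI finite_imageI finite_insert)
qed

lemma zero_one_digits:
  assumes "m \<ge> 2" "t \<in> zero_one m"
  shows "t div m \<in> zero_one m" "t mod m = 0 \<or> t mod m = 1"
proof -
  obtain I where I: "finite I" "t = (\<Sum>i\<in>I. m ^ i)"
    using assms unfolding zero_one_def by blast
  define J where "J = Suc -` I"
  have fin: "finite J"
    using I(1) unfolding J_def by (simp add: finite_vimageI)
  define u where "u = (\<Sum>i\<in>J. m ^ i)"
  have u: "u \<in> zero_one m"
    using fin unfolding zero_one_def u_def by blast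
  have "I = Suc ` J \<union> (I \<inter> {0})"
    unfolding J_def by (auto simp: image_iff gr0_conv_Suc)
  then have "t = (\<Sum>i\<in>Suc ` J \<union> (I \<inter> {0}). m ^ i)"
    using I(2) by simp
  also have "\<dots> = m * u + (\<Sum>i\<in>I \<inter> {0}. m ^ i)"
    using fin by (subst sum.union_disjoint) (auto simp: sum_power_Suc_image u_def)
  also have "(\<Sum>i\<in>I \<inter> {0}. m ^ i) = (if 0 \<in> I then 1 else 0)"
    by auto
  finally have "t = m * u + (if 0 \<in> I then 1 else 0)" .
  then have "t div m = u \<and> (t mod m = 0 \<or> t mod m = 1)"
    using assms(1) by (auto split: if_splits)
  then show "t div m \<in> zero_one m" "t mod m = 0 \<or> t mod m = 1"
    using u by auto
qed

lemma zero_one_less: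
  assumes "m \<ge> 2" "t \<in> zero_one m" "t < m"
  shows "t = 0 \<or> t = 1"
  using zero_one_digits(2)[OF assms(1,2)] assms(3) by simp

lemma zero_one_infinite:
  assumes "m \<ge> 2"
  shows "infinite (zero_one m)"
proof -
  have "m ^ i \<in> zero_one m" for i
    unfolding zero_one_def by (rule CollectI, rule exI[of _ "{i}"]) simp
  then have "range ((^) m) \<subseteq> zero_one m" by blast
  moreover have "inj ((^) m)"
    using assms by (simp add: inj_on_def)
  ultimately show ?thesis
    using finite_subset range_inj_infinite by blast
qed

text \<open>Split off the lowest digits and let \<open>D\<close> be the set of indices with digit 1.
  Modulo m the equation says that m divides \<open>card D - k\<close>, which leaves only
  \<open>D\<close> empty, full, a singleton or the complement of one. The quotients satisfy an
  equation of the same kind with a new defect in {-1, 0, 1}, so induction on the total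
  applies.\<close>

lemma digit_balance:
  fixes t :: "'a \<Rightarrow> nat" and k :: int
  assumes m: "m \<ge> 3" and I: "finite I" "card I = m" "y \<in> I"
    and t: "\<forall>i\<in>I. t i \<in> zero_one m"
    and eq: "(\<Sum>i\<in>I. int (t i)) = int m * int (t y) + k" and k: "\<bar>k\<bar> \<le> 1"
  shows "(k = 0 \<longrightarrow> (\<forall>i\<in>I. t i = t y)) \<and>
    (\<exists>j\<in>I. j \<noteq> y \<and> (\<forall>i\<in>I - {j, y}. \<forall>i'\<in>I - {j, y}. t i = t i'))"
  using t eq k
proof (induction "\<Sum>i\<in>I. t i" arbitrary: t k rule: less_induct)
  case less
  obtain j0 where j0: "j0 \<in> I" "j0 \<noteq> y"
  proof -
    have "I \<noteq> {y}" using I m by auto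
    then show ?thesis using that I(3) by blast
  qed
  show ?case
  proof (cases "(\<Sum>i\<in>I. t i) = 0")
    case True
    then have "t i = 0" if "i \<in> I" for i using that I by simp
    then show ?thesis using j0 I by auto
  next
    case False
    define u where "u i = t i div m" for i
    define D where "D = {i \<in> I. t i mod m = 1}"
    define d :: int where "d = (if y \<in> D then 1 else 0)"
    have ti: "t i = m * u i + (if i \<in> D then 1 else 0)" if "i \<in> I" for i
    proof -
      have "t i mod m = 0 \<or> t i mod m = 1"
        using zero_one_digits(2)[of m "t i"] less.prems(1) that m by auto
      then show ?thesis
        using mult_div_mod_eq[of m "t i"] that unfolding u_def D_def mem_Collect_eq
        by (metis One_nat_def zero_neq_one)
    qed
    have uT: "\<forall>i\<in>I. u i \<in> zero_one m"
      using zero_one_digits(1)[of m] less.prems(1) m unfolding u_def by auto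
    have D: "D \<subseteq> I" "finite D" using I unfolding D_def by auto
    have "(\<Sum>i\<in>I. t i) = (\<Sum>i\<in>I. m * u i + (if i \<in> D then 1 else 0))"
      using ti by (rule sum.cong[OF refl])
    also have "\<dots> = m * (\<Sum>i\<in>I. u i) + card D"
      using I D by (simp add: sum.distrib sum_distrib_left sum.If_cases Int_absorb1)
    finally have sum_t: "(\<Sum>i\<in>I. t i) = m * (\<Sum>i\<in>I. u i) + card D" .
    have less_u: "(\<Sum>i\<in>I. u i) < (\<Sum>i\<in>I. t i)"
    proof (cases "(\<Sum>i\<in>I. u i) = 0")
      case False
      then have "1 * (\<Sum>i\<in>I. u i) < m * (\<Sum>i\<in>I. u i)"
        using m by (intro mult_strict_right_mono) auto
      then show ?thesis using sum_t by linarith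
    qed (use \<open>(\<Sum>i\<in>I. t i) \<noteq> 0\<close> in simp)
    \<comment> \<open>\<open>q\<close> is the carry: \<open>card D = m * q + k\<close>, and the
      quotients satisfy the equation with defect \<open>d - q\<close>.\<close>
    define q :: int where "q = int m * int (u y) + d - int (\<Sum>i\<in>I. u i)"
    have "int m * int (\<Sum>i\<in>I. u i) + int (card D) = int m * (int m * int (u y) + d) + k"
      using less.prems(2) sum_t ti[OF I(3)] unfolding d_def by (auto simp flip: of_nat_sum of_nat_mult)
    then have q: "int (card D) - k = int m * q"
      unfolding q_def by (simp add: algebra_simps)
    have cD: "card D \<le> m" using D I card_mono by blast
    have q01: "q = 0 \<or> q = 1"
    proof -
      have "int m * q < int m * 2" "int m * q > int m * (-1)"
        using q cD less.prems(3) m by linarith+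
      then have "q < 2" "-1 < q"
        using mult_less_cancel_left_pos[of "int m" q 2] mult_less_cancel_left_pos[of "int m" "-1" q] m
        by auto
      then show ?thesis by linarith
    qed
    have cases: "q = 0 \<and> k = 0 \<and> D = {} \<or> q = 1 \<and> k = 0 \<and> D = I \<or>
      q = 0 \<and> k = 1 \<and> card D = 1 \<or> q = 1 \<and> k = -1 \<and> card (I - D) = 1"
    proof -
      have k3: "k = 0 \<or> k = 1 \<or> k = -1" using less.prems(3) by linarith
      have c: "card (I - D) = m - card D" using D I by (simp add: card_Diff_subset)
      have "D = I" if "card D = m" using that D I by (simp add: card_subset_eq)
      moreover have "D = {}" if "card D = 0" using that D by simp
      ultimately show ?thesis using q01 k3 q c cD m
        by (elim disjE) (auto simp: of_nat_diff)
    qed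
    have sum_u: "(\<Sum>i\<in>I. int (u i)) = int m * int (u y) + (d - q)"
      unfolding q_def by simp
    have "\<bar>d - q\<bar> \<le> 1" using q01 unfolding d_def by auto
    note IH = less.hyps[OF less_u uT sum_u this]
    have all_u: "u i = u y" if "d = q" "i \<in> I" for i using IH that by auto
    show ?thesis
    proof (cases "k = 0")
      case True
      then have "d = q" "D = {} \<or> D = I" using cases I unfolding d_def by auto
      then have "t i = t y" if "i \<in> I" for i
        using all_u[OF _ that] ti[OF that] ti[OF I(3)] that I(3) by auto
      then show ?thesis using j0 by auto
    next
      case False
      then obtain j where "q = 0 \<and> D = {j} \<or> q = 1 \<and> I - D = {j}"
        using cases by (auto simp: card_1_singleton_iff)
      then have j: "j \<in> I" "q = 0 \<and> D = {j} \<or> q = 1 \<and> D = I - {j}"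
        using D by auto
      have tj: "t i = m * u i + nat q" if "i \<in> I - {j}" for i
        using ti[of i] j that by auto
      show ?thesis
      \<comment> \<open>If the exceptional digit sits at \<open>y\<close>, all other digits agree
        and the exception among the quotients comes from the induction hypothesis. Otherwise
        \<open>d = q\<close>, all quotients agree and \<open>j\<close> is the only
        exception.\<close>
      proof (cases "j = y")
        case True
        obtain j' where "j' \<in> I" "j' \<noteq> y" "\<forall>i\<in>I - {j', y}. \<forall>i'\<in>I - {j', y}. u i = u i'"
          using IH by blast
        moreover have "t i = t i'" if "i \<in> I - {j', y}" "i' \<in> I - {j', y}" for i i'
          using that calculation(3) tj True by (metis DiffD1 DiffD2 DiffI insertCI singletonD)
        ultimately show ?thesis using False by blast
      next
        case False
        then have "d = q" using j I(3) unfolding d_def by auto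
        then have "t i = t i'" if "i \<in> I - {j, y}" "i' \<in> I - {j, y}" for i i'
          using all_u tj that by (metis DiffD1 DiffD2 DiffI insertCI singletonD)
        then show ?thesis using False j(1) \<open>k \<noteq> 0\<close> by blast
      qed
    qed
  qed
qed

section \<open>Absence of mean solutions\<close>

definition base_set :: "nat \<Rightarrow> nat \<Rightarrow> nat set \<Rightarrow> nat set" where
  "base_set m c R = {c * t + r | t r. t \<in> zero_one m \<and> r \<in> R}"

lemma base_setI: "t \<in> zero_one m \<Longrightarrow> r \<in> R \<Longrightarrow> c * t + r \<in> base_set m c R"
  unfolding base_set_def by blast

lemma base_set_iff:
  assumes "R \<subseteq> {..<c}"
  shows "x \<in> base_set m c R \<longleftrightarrow> x div c \<in> zero_one m \<and> x mod c \<in> R"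
proof
  assume "x \<in> base_set m c R"
  then obtain t r where "t \<in> zero_one m" "r \<in> R" "x = c * t + r"
    unfolding base_set_def by blast
  then show "x div c \<in> zero_one m \<and> x mod c \<in> R"
    using assms by auto
next
  assume "x div c \<in> zero_one m \<and> x mod c \<in> R"
  then show "x \<in> base_set m c R"
    using base_setI[of "x div c" m "x mod c" R c] by (simp add: mult_div_mod_eq)
qed

section \<open>Extremal sums of distinct numbers\<close>

lemma sum_distinct_nat_ge:
  fixes W :: "nat set"
  assumes "finite W"
  shows "card W * (card W - 1) \<le> 2 * \<Sum>W"
proof -
  have "\<Sum>{..<card W} \<le> \<Sum>W"
    using assms
  proof (induction "card W" arbitrary: W)
    case (Suc k)
    have ne: "W \<noteq> {}" using Suc by auto
    have "card (W - {Max W}) = k" using Suc ne by simp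
    then have "\<Sum>{..<k} \<le> \<Sum>(W - {Max W})"
      using Suc.hyps(1)[of "W - {Max W}"] Suc.prems by simp
    moreover have "\<Sum>W = Max W + \<Sum>(W - {Max W})"
      using Suc.prems ne sum.remove[of W "Max W" "\<lambda>x. x"] by simp
    moreover have "k \<le> Max W"
    proof -
      have "W \<subseteq> {..Max W}" using Suc.prems by auto
      then show ?thesis using card_mono[of "{..Max W}" W] Suc.hyps(2) by simp
    qed
    ultimately show ?case using Suc.hyps(2) by (simp flip: Suc.hyps(2))
  qed simp
  moreover have "2 * \<Sum>{..<n} = n * (n - 1)" for n :: nat
    using gauss_sum_nat[of "n - 1"] by (cases n) (simp_all add: lessThan_Suc_atMost atLeast0AtMost)
  ultimately show ?thesis by (metis mult_le_mono2)
qed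

text \<open>The reflection of x to M - x turns the lower bound into an upper one.\<close>

lemma sum_distinct_nat_le:
  fixes W :: "nat set"
  assumes "W \<subseteq> {..M}"
  shows "2 * \<Sum>W + card W * (card W - 1) \<le> 2 * card W * M"
proof -
  have fin: "finite W" using assms finite_subset by blast
  have inj: "inj_on (\<lambda>x. M - x) W" 
    by (rule inj_on_inverseI[where g = "\<lambda>x. M - x"]) (use assms in auto)
  have "\<Sum>((\<lambda>x. M - x) ` W) + \<Sum>W = (\<Sum>x\<in>W. (M - x) + x)"
    using inj by (simp add: sum.reindex sum.distrib)
  also have "\<dots> = (\<Sum>x\<in>W. M)"
    using assms by (intro sum.cong) auto
  finally show ?thesis
    using sum_distinct_nat_ge[of "(\<lambda>x. M - x) ` W"] fin inj by (simp add: card_image)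
qed

text \<open>The bound on (m - 1) M keeps the defect \<open>k\<close> of the quotient equation in
  {-1, 0, 1}. If it is not 0, then m - 2 elements share a quotient and hence have distinct residues.
  The sum of these stays (m - 2)(m - 3)/2 away from both extremes 0 and (m - 2) M, so the last bound
  on c gives |K| < c.\<close>

lemma base_set_mean_free:
  assumes m: "m \<ge> 3" and R: "R \<subseteq> {..M}" and c: "M < c" "(m - 1) * M < 2 * c"
    "2 * (m - 1) * M < 2 * c + (m - 2) * (m - 3)"
    and free: "\<not> has_mean_solution m R"
  shows "\<not> has_mean_solution m (base_set m c R)"
proof
  have Rc: "R \<subseteq> {..<c}" using R c(1) by auto
  assume "has_mean_solution m (base_set m c R)"
  then obtain y W where W: "y \<in> base_set m c R" "W \<subseteq> base_set m c R" "finite W" "y \<notin> W"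
    "card W = m - 1" "\<Sum>W = (m - 1) * y"
    using has_mean_solution_iff[of m] m by auto
  define I where "I = insert y W"
  have I: "finite I" "card I = m" "y \<in> I" "W = I - {y}"
    using W m unfolding I_def by auto
  define t r where "t x = x div c" and "r x = x mod c" for x
  have tr: "x = c * t x + r x" for x unfolding t_def r_def by simp
  have tI: "\<forall>i\<in>I. t i \<in> zero_one m" and rI: "\<forall>i\<in>I. r i \<in> R"
    using base_set_iff[OF Rc, of _ m] W(1,2) unfolding t_def r_def I_def by auto
  have rM: "r i \<le> M" if "i \<in> I" for i using rI R that by blast
  \<comment> \<open>The mean equation says exactly that the residue defect \<open>K\<close> is c
    times the quotient defect \<open>k\<close>.\<close>
  define k where "k = (\<Sum>i\<in>I. int (t i)) - int m * int (t y)"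
  define K where "K = int (m - 1) * int (r y) - (\<Sum>i\<in>W. int (r i))"
  have "(\<Sum>i\<in>W. c * t i + r i) = (m - 1) * (c * t y + r y)"
    using W(6) by (simp flip: tr)
  from arg_cong[OF this, of int] have "int c * (\<Sum>i\<in>W. int (t i)) + (\<Sum>i\<in>W. int (r i)) = int (m - 1) * (int c * int (t y) + int (r y))"
    by (simp add: sum.distrib sum_distrib_left)
  moreover have "(\<Sum>i\<in>I. int (t i)) = int (t y) + (\<Sum>i\<in>W. int (t i))"
    using W(3,4) unfolding I_def by simp
  ultimately have K: "K = int c * k"
    unfolding k_def K_def using m by (simp add: algebra_simps of_nat_diff)
  have c0: "int c > 0" using c(1) by simp
  have k1: "\<bar>k\<bar> \<le> 1"
  proof -
    have "(\<Sum>i\<in>W. r i) \<le> (m - 1) * M"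
      using sum_bounded_above[of W r M] rM W(5) unfolding I_def by auto
    then have "(\<Sum>i\<in>W. int (r i)) < 2 * int c"
      using c(2) by (simp flip: of_nat_sum)
    moreover have "(m - 1) * r y \<le> (m - 1) * M" using rM I(3) by (intro mult_le_mono2)
    then have "(m - 1) * r y < 2 * c" using c(2) by linarith
    then have "int ((m - 1) * r y) < int (2 * c)" by (simp only: of_nat_less_iff)
    then have "int (m - 1) * int (r y) < 2 * int c" by simp
    moreover have "(\<Sum>i\<in>W. int (r i)) \<ge> 0" by (simp add: sum_nonneg)
    moreover have "int (m - 1) * int (r y) \<ge> 0" by simp
    ultimately have "int c * k < int c * 2" "int c * k > int c * (-2)"
      using K unfolding K_def by linarith+
    then have "k < 2" "-2 < k"
      using mult_less_cancel_left_pos[OF c0] by blast+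
    then show ?thesis by linarith
  qed
  have bal: "(\<Sum>i\<in>I. int (t i)) = int m * int (t y) + k" unfolding k_def by simp
  note db = digit_balance[OF m I(1,2,3) tI bal k1]
  have inj: "inj_on r J" if "\<forall>i\<in>J. \<forall>i'\<in>J. t i = t i'" for J
    using that tr by (metis inj_onI)
  show False
  proof (cases "k = 0")
    case True
    then have "\<forall>i\<in>I. \<forall>i'\<in>I. t i = t i'" using db by metis
    then have injI: "inj_on r I" by (rule inj)
    then have injW: "inj_on r W" and "r y \<notin> r ` W"
      using W(4) unfolding I_def by auto
    moreover have "card (r ` W) = m - 1" using injW W(5) by (simp add: card_image)
    moreover have "\<Sum>(r ` W) = (\<Sum>i\<in>W. r i)"
      using injW by (simp add: sum.reindex)
    moreover have "(\<Sum>i\<in>W. r i) = (m - 1) * r y"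
      using K True unfolding K_def by (simp flip: of_nat_sum of_nat_mult)
    moreover have "r y \<in> R" "r ` W \<subseteq> R" using rI unfolding I_def by auto
    ultimately have "has_mean_solution m R"
      using has_mean_solution_iff[of m R] m W(3)
      by (metis One_nat_def Suc_leD finite_imageI numeral_3_eq_3)
    then show False using free by contradiction
  next
    case False
    obtain j where j: "j \<in> I" "j \<noteq> y" "\<forall>i\<in>I - {j, y}. \<forall>i'\<in>I - {j, y}. t i = t i'"
      using db by blast
    define J where "J = I - {j, y}"
    have injJ: "inj_on r J" using inj j(3) unfolding J_def by blast
    have J: "finite J" "card J = m - 2"
      using I j(1,2) unfolding J_def by auto
    define V where "V = r ` J"
    have V: "card V = m - 2" "finite V" "V \<subseteq> {..M}"
      using injJ J rM unfolding V_def J_def by (auto simp: card_image)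
    have lo: "(m - 2) * (m - 3) \<le> 2 * \<Sum>V" and hi: "2 * \<Sum>V + (m - 2) * (m - 3) \<le> 2 * (m - 2) * M"
      using sum_distinct_nat_ge[OF V(2)] sum_distinct_nat_le[OF V(3)] V(1)
      by (simp_all add: numeral_3_eq_3 numeral_2_eq_2)
    have "W = insert j J" "j \<notin> J" using I(4) j(1,2) unfolding J_def by auto
    then have sW: "(\<Sum>i\<in>W. int (r i)) = int (r j) + int (\<Sum>V)"
      using J(1) injJ unfolding V_def by (simp add: sum.reindex)
    have "(m - 1) * M = M + (m - 2) * M"
    proof -
      obtain l where "m = l + 2" using m that[of "m - 2"] by simp
      then show ?thesis by simp
    qed
    then have M: "2 * (m - 1) * M = 2 * M + 2 * ((m - 2) * M)" "2 * (m - 2) * M = 2 * ((m - 2) * M)"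
      "(m - 1) * r y \<le> M + (m - 2) * M"
      using rM[OF I(3)] mult_le_mono2[of "r y" M "m - 1"] by simp_all
    have "K = int ((m - 1) * r y) - (int (r j) + int (\<Sum>V))"
      using sW unfolding K_def by simp
    then have "\<bar>K\<bar> < int c"
      using lo hi c(3) M rM[OF j(1)] by linarith
    then have "\<bar>k\<bar> * int c < 1 * int c" using K c0 by (simp add: abs_mult mult.commute)
    then show False using False c0 by simp
  qed
qed

section \<open>Filling the gaps\<close>

text \<open>Proceed digit by digit, with \<delta> the last digit of q. For \<delta> = 0 append 0
  everywhere; otherwise append 1 to \<open>t\<close> and to m - 1 - \<delta> of the
  \<open>z w\<close>, since \<delta> + (m - 1 - \<delta>) = m - 1. A digit above 1 leaves room to
  spare \<open>w0\<close>, which makes \<open>z w0 < t\<close>, and lower digits preserve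
  this.\<close>

lemma digit_average:
  assumes m: "m \<ge> 3" and W: "finite W" "card W = m - 2" "w0 \<in> W"
  shows "\<exists>t z. t \<in> zero_one m \<and> (\<forall>w\<in>W. z w \<in> zero_one m \<and> z w \<le> t) \<and> t \<le> q \<and>
    q + (\<Sum>w\<in>W. z w) = (m - 1) * t \<and> (q \<notin> zero_one m \<longrightarrow> t < q \<and> z w0 < t)"
proof (induction q rule: less_induct)
  case (less q)
  show ?case
  proof (cases "q = 0")
    case True
    then show ?thesis
      using zero_one_0 by (intro exI[of _ 0] exI[of _ "\<lambda>_. 0"]) auto
  next
    case False
    define q' \<delta> where "q' = q div m" and "\<delta> = q mod m"
    have q: "q = m * q' + \<delta>" "\<delta> < m" using m unfolding q'_def \<delta>_def by auto
    have "q' < q" using False m unfolding q'_def by simp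
    from less.IH[OF this] obtain t z where tz: "t \<in> zero_one m"
      "\<forall>w\<in>W. z w \<in> zero_one m \<and> z w \<le> t" "t \<le> q'" "q' + (\<Sum>w\<in>W. z w) = (m - 1) * t"
      "q' \<notin> zero_one m \<longrightarrow> t < q' \<and> z w0 < t"
      by blast
    show ?thesis
    proof (cases "\<delta> = 0")
      case True
      have "q \<notin> zero_one m \<longrightarrow> q' \<notin> zero_one m"
        using zero_one_shift[of q' m] q True by auto
      moreover have "q + (\<Sum>w\<in>W. m * z w) = (m - 1) * (m * t)"
        using tz(4) q(1) True by (simp add: algebra_simps flip: sum_distrib_left distrib_left)
      ultimately show ?thesis
        using tz q True zero_one_shift m
        by (intro exI[of _ "m * t"] exI[of _ "\<lambda>w. m * z w"]) auto
    next
      case False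
      have "\<exists>V\<subseteq>W. card V = m - 1 - \<delta> \<and> (\<delta> > 1 \<longrightarrow> w0 \<notin> V)"
      proof (cases "\<delta> = 1")
        case True
        then show ?thesis using W(2) by (intro exI[of _ W]) (auto simp: numeral_2_eq_2)
      next
        case F: False
        have "m - 1 - \<delta> \<le> card (W - {w0})" using W F False m by simp
        then obtain V where "V \<subseteq> W - {w0}" "card V = m - 1 - \<delta>"
          using obtain_subset_with_card_n by metis
        then show ?thesis by blast
      qed
      then obtain V where V: "V \<subseteq> W" "card V = m - 1 - \<delta>" "\<delta> > 1 \<longrightarrow> w0 \<notin> V" by blast
      define z' where "z' w = m * z w + (if w \<in> V then 1 else 0)" for w
      have sum_z': "(\<Sum>w\<in>W. z' w) = m * (\<Sum>w\<in>W. z w) + (m - 1 - \<delta>)"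
        using W V unfolding z'_def
        by (simp add: sum.distrib sum_distrib_left sum.If_cases Int_absorb1)
      have "q + (\<Sum>w\<in>W. z' w) = m * (q' + (\<Sum>w\<in>W. z w)) + (m - 1)"
        using sum_z' q by (simp add: algebra_simps)
      also have "\<dots> = (m - 1) * (m * t + 1)"
        using tz(4) by (simp add: algebra_simps)
      finally have eq: "q + (\<Sum>w\<in>W. z' w) = (m - 1) * (m * t + 1)" .
      have le: "z' w \<in> zero_one m \<and> z' w \<le> m * t + 1" if "w \<in> W" for w
        using tz(2) that zero_one_shift zero_one_shift1[of "z w" m] m unfolding z'_def
        by (auto intro: le_SucI)
      have strict: "m * t + 1 < q \<and> z' w0 < m * t + 1" if "q \<notin> zero_one m"
      proof (cases "\<delta> = 1")
        case True
        then have "q' \<notin> zero_one m" using that q zero_one_shift1 by metis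
        then have "t < q'" "z w0 < t" using tz by auto
        then have "m * t < m * q'" "m * z w0 < m * t" using m by auto
        moreover have "z' w0 \<le> m * z w0 + 1" unfolding z'_def by simp
        ultimately show ?thesis using True q(1) by linarith
      next
        case F: False
        have "m * t \<le> m * q'" "m * z w0 \<le> m * t" using tz W(3) by auto
        moreover have "z' w0 = m * z w0" "\<delta> > 1" using F False V(3) unfolding z'_def by auto
        ultimately show ?thesis using q(1) by linarith
      qed
      have "m * t \<le> m * q'" using tz(3) by simp
      then have "m * t + 1 \<le> q" using q(1) False by linarith
      then show ?thesis
        using eq le strict zero_one_shift1[OF tz(1)]
        by (intro exI[of _ "m * t + 1"] exI[of _ z']) auto
    qed
  qed
qed

text \<open>Since some \<open>z w\<close> in \<open>digit_average\<close> is smaller than \<open>t\<close>, the residue \<open>y\<close> of the mean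
  may coincide with one of the other residues.\<close>

lemma blocked_lift:
  assumes m: "m \<ge> 3" and R: "R \<subseteq> {..<c}" and q: "q \<notin> zero_one m"
    and y: "y \<in> R" and W: "W \<subseteq> R" "card W = m - 2" and eq: "s + \<Sum>W = (m - 1) * y"
  shows "\<exists>Y Z. Y \<in> base_set m c R \<and> Z \<subseteq> base_set m c R \<and> Y < c * q \<and> Z \<subseteq> {..<c * q} \<and>
    Y \<notin> Z \<and> card Z = m - 2 \<and> (c * q + s) + \<Sum>Z = (m - 1) * Y"
proof -
  have fin: "finite W" using W R finite_subset[of _ "{..<c}"] by blast
  have "W \<noteq> {}" using W m by auto
  \<comment> \<open>Only the element of \<open>W\<close> with residue \<open>y\<close> could collide
    with the mean, so the strict inequality is placed there.\<close>
  then obtain w0 where w0: "w0 \<in> W" "y \<in> W \<longrightarrow> w0 = y" by blast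
  obtain t z where tz: "t \<in> zero_one m" "\<forall>w\<in>W. z w \<in> zero_one m \<and> z w \<le> t"
    "q + (\<Sum>w\<in>W. z w) = (m - 1) * t" "t < q" "z w0 < t"
    using digit_average[OF m fin W(2) w0(1), of q] q by blast
  have small: "c * u + r < c * q" if "u < q" "r \<in> R" for u r
  proof -
    have "c * u + r < c * (u + 1)" using that R by auto
    also have "\<dots> \<le> c * q" using that by (intro mult_le_mono2) simp
    finally show ?thesis .
  qed
  define f where "f w = c * z w + w" for w
  have f_mod: "f w mod c = w" if "w \<in> W" for w using that W R unfolding f_def by auto
  have inj: "inj_on f W" by (rule inj_on_inverseI[where g = "\<lambda>x. x mod c"]) (rule f_mod)
  show ?thesis
  proof (intro exI conjI)
    show "c * t + y \<in> base_set m c R" using tz y by (intro base_setI)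
    show "f ` W \<subseteq> base_set m c R" using tz W unfolding f_def by (auto intro: base_setI)
    show "c * t + y < c * q" using small tz y by simp
    show "f ` W \<subseteq> {..<c * q}"
      using small tz W unfolding f_def by (auto intro!: small intro: le_less_trans)
    show "c * t + y \<notin> f ` W"
    proof
      assume "c * t + y \<in> f ` W"
      then obtain w where w: "w \<in> W" "c * t + y = f w" by blast
      have "y < c" using y R by auto
      then have "w = y" using f_mod[OF w(1)] w(2)[symmetric] by simp
      moreover from this have "w0 = y" using w w0 by simp
      ultimately show False using w(2) tz(5) \<open>y < c\<close> unfolding f_def by simp
    qed
    show "card (f ` W) = m - 2" using inj W by (simp add: card_image)
    have "\<Sum>(f ` W) = c * (\<Sum>w\<in>W. z w) + \<Sum>W"
      using inj unfolding f_def by (simp add: sum.reindex sum.distrib sum_distrib_left)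
    then have "(c * q + s) + \<Sum>(f ` W) = c * (q + (\<Sum>w\<in>W. z w)) + (s + \<Sum>W)"
      by (simp add: algebra_simps)
    then show "(c * q + s) + \<Sum>(f ` W) = (m - 1) * (c * t + y)"
      using tz(3) eq by (simp add: algebra_simps)
  qed
qed

text \<open>Both sides of the equation carry the total weight m - 1, so it is invariant under
  translation by \<open>d\<close>.\<close>

lemma blocked_translate:
  assumes m: "m \<ge> 2" and b: "blocked m A b" and A: "\<And>a. a \<in> A \<Longrightarrow> d + a \<in> B"
  shows "blocked m B (d + b)"
proof -
  obtain y W where y: "y \<in> A" "y < b" "W \<subseteq> A" "W \<subseteq> {..<b}" "y \<notin> W" "card W = m - 2"
    "b + \<Sum>W = (m - 1) * y"
    using b unfolding blocked_def by blast
  have "(d + b) + \<Sum>((+) d ` W) = (m - 1) * d + (b + \<Sum>W)"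
  proof -
    obtain k where "m = k + 2" using m by (metis add.commute le_Suc_ex)
    then show ?thesis using y(6) by (simp add: sum.reindex sum.distrib algebra_simps)
  qed
  then have "(d + b) + \<Sum>((+) d ` W) = (m - 1) * (d + y)"
    using y(7) by (simp add: distrib_left)
  then show ?thesis
    using y A by (intro blockedI[of "d + y" _ _ "(+) d ` W"]) (auto simp: card_image)
qed

text \<open>Let b = c q + s be a gap. If q is in \<open>zero_one m\<close>, a solution for s is
  translated by c q. For other q a combination is lifted below c q, where order and distinctness
  come from the quotients. There s may lie in \<open>R\<close>, and \<open>inside\<close> provides
  the bare equation for it.\<close>

lemma range_S_seq_base_set:
  assumes m: "m \<ge> 3" and R: "R \<subseteq> {..M}" "0 \<in> R" and c: "M < c" "(m - 1) * M < 2 * c"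
    "2 * (m - 1) * M < 2 * c + (m - 2) * (m - 3)"
    and free: "\<not> has_mean_solution m R"
    and outside: "\<And>s. s < c \<Longrightarrow> s \<notin> R \<Longrightarrow> blocked m R s"
    and inside: "\<And>s. s \<in> R \<Longrightarrow> \<exists>y W. y \<in> R \<and> W \<subseteq> R \<and> card W = m - 2 \<and> s + \<Sum>W = (m - 1) * y"
  shows "range (S_seq m) = base_set m c R"
proof (rule range_S_seq_eq)
  have Rc: "R \<subseteq> {..<c}" using R c(1) by auto
  have c0: "c > 0" using c(1) by simp
  show "0 \<in> base_set m c R" using base_setI[OF zero_one_0 R(2), of c m] by simp
  show "infinite (base_set m c R)"
  proof -
    have "(*) c ` zero_one m \<subseteq> base_set m c R"
      using base_setI[of _ m 0 R c] R(2) by auto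
    moreover have "infinite ((*) c ` zero_one m)"
      using zero_one_infinite[of m] m c0 by (subst finite_image_iff) (auto simp: inj_on_def)
    ultimately show ?thesis using finite_subset by blast
  qed
  show "\<not> has_mean_solution m (base_set m c R)"
    by (rule base_set_mean_free[OF m R(1) c free])
  fix b assume b: "b \<notin> base_set m c R"
  define q s where "q = b div c" and "s = b mod c"
  have qs: "b = c * q + s" "s < c" using c0 unfolding q_def s_def by auto
  have "blocked m (base_set m c R) b"
  proof (cases "q \<in> zero_one m")
    case True
    then have "s \<notin> R" using b qs(1) base_setI by metis
    then show ?thesis
      unfolding qs(1) using outside qs(2) m True by (intro blocked_translate[of m R]) (auto intro: base_setI)
  next
    case False
    have "\<exists>y W. y \<in> R \<and> W \<subseteq> R \<and> card W = m - 2 \<and> s + \<Sum>W = (m - 1) * y"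
      using inside outside[OF qs(2)] unfolding blocked_def by blast
    then obtain y W where "y \<in> R" "W \<subseteq> R" "card W = m - 2" "s + \<Sum>W = (m - 1) * y" by blast
    from blocked_lift[OF m Rc False this]
    obtain Y Z where YZ: "Y \<in> base_set m c R" "Z \<subseteq> base_set m c R" "Y < c * q" "Z \<subseteq> {..<c * q}"
      "Y \<notin> Z" "card Z = m - 2" "b + \<Sum>Z = (m - 1) * Y"
      unfolding qs(1) by blast
    moreover have "Z \<subseteq> {..<b}" "Y < b" using YZ(3,4) qs(1) by auto
    ultimately show ?thesis by (intro blockedI)
  qed
  then show "has_mean_solution m (insert b {a \<in> base_set m c R. a < b})"
    using blocked_has_mean_solution m by simp
qed

section \<open>Even \<open>m\<close>\<close>

text \<open>Sets of nearly full size are described by the two or three elements they omit; the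
  additive form avoids truncated subtraction.\<close>

lemma sum_Diff2:
  fixes A :: "nat set"
  assumes "finite A" "a \<in> A" "b \<in> A" "a \<noteq> b"
  shows "\<Sum>(A - {a, b}) + a + b = \<Sum>A" "card (A - {a, b}) = card A - 2"
proof -
  have "\<Sum>A = a + (b + \<Sum>(A - {a} - {b}))"
    using assms sum.remove[of A a "\<lambda>x. x"] sum.remove[of "A - {a}" b "\<lambda>x. x"] by simp
  moreover have "A - {a} - {b} = A - {a, b}" by blast
  ultimately show "\<Sum>(A - {a, b}) + a + b = \<Sum>A" by simp
  show "card (A - {a, b}) = card A - 2"
    using assms by (simp add: card_Diff_subset)
qed

lemma sum_Diff3:
  fixes A :: "nat set"
  assumes "finite A" "a \<in> A" "b \<in> A" "d \<in> A" "a \<noteq> b" "a \<noteq> d" "b \<noteq> d"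
  shows "\<Sum>(A - {a, b, d}) + a + b + d = \<Sum>A" "card (A - {a, b, d}) = card A - 3"
proof -
  have "A - {a, b, d} = A - {a, b} - {d}" by blast
  moreover have "\<Sum>(A - {a, b}) = d + \<Sum>(A - {a, b} - {d})"
    using assms sum.remove[of "A - {a, b}" d "\<lambda>x. x"] by simp
  ultimately show "\<Sum>(A - {a, b, d}) + a + b + d = \<Sum>A"
    using sum_Diff2(1)[of A a b] assms by simp
  show "card (A - {a, b, d}) = card A - 3"
    using assms by (simp add: card_Diff_subset)
qed

lemma subset_card_Suc_obtain:
  assumes "finite A" "W \<subseteq> A" "card A = Suc (card W)"
  obtains u where "u \<in> A" "u \<notin> W" "A = insert u W"
proof -
  have "card (A - W) = 1" using assms finite_subset by (subst card_Diff_subset) auto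
  then obtain u where "A - W = {u}" by (auto simp: card_1_singleton_iff)
  then show ?thesis using that[of u] assms(2) by blast
qed

lemma sum_subset_le:
  fixes A :: "nat set"
  assumes "finite A" "W \<subseteq> A"
  shows "\<Sum>W \<le> \<Sum>A"
  using assms by (intro sum_mono2) auto

lemma sum_atMost_even: "\<Sum>{0..2 * n} = n * (2 * n + 1)" for n :: nat
  by (induction n) (auto simp: algebra_simps)

text \<open>\<open>W\<close> and \<open>y\<close> leave out a single u, and the total n (2 n + 1)
  gives 2 n^2 + n = 2 n y + u. As u is at most 2 n, this forces y = n = u, but u differs from
  y.\<close>

lemma even_mean_free:
  assumes n: "n \<ge> 1"
  shows "\<not> has_mean_solution (2 * n) {0..2 * n}"
proof
  assume "has_mean_solution (2 * n) {0..2 * n}"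
  then obtain y W where W: "y \<in> {0..2 * n}" "W \<subseteq> {0..2 * n}" "finite W" "y \<notin> W" "card W = 2 * n - 1"
    "\<Sum>W = (2 * n - 1) * y"
    using has_mean_solution_iff[of "2 * n"] n by auto
  have "card {0..2 * n} = Suc (card (insert y W))" using W n by simp
  then obtain u where u: "u \<in> {0..2 * n}" "u \<notin> insert y W" "{0..2 * n} = insert u (insert y W)"
    using subset_card_Suc_obtain[of "{0..2 * n}" "insert y W"] W by auto
  have "n * (2 * n + 1) = u + (y + \<Sum>W)"
    using u W sum_atMost_even[of n] by simp
  also have "\<dots> = 2 * n * y + u" using W(6) n by (simp add: algebra_simps)
  finally have eq: "2 * n * n + n = 2 * n * y + u" by (simp add: algebra_simps)
  consider "y = n" | "y + 1 \<le> n" | "n + 1 \<le> y" by linarith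
  then show False
  proof cases
    case 1
    then show False using eq u by simp
  next
    case 2
    then have "2 * n * (y + 1) \<le> 2 * n * n" by (intro mult_le_mono2)
    then have "2 * n * y + 2 * n \<le> 2 * n * n" by simp
    moreover have "u \<le> 2 * n" using u(1) by simp
    ultimately show False using eq n by linarith
  next
    case 3
    then have "2 * n * (n + 1) \<le> 2 * n * y" by (intro mult_le_mono2)
    then show False using eq n by simp
  qed
qed

text \<open>\<open>W\<close> is {0..2 n} without the mean y and two further elements a, b, so s + 2
  n^2 + n = 2 n y + a + b has to be solved. The largest s reached, with y = 2 n and a, b equal to 2
  n - 1 and 2 n - 2, is 2 n^2 + 3 n - 3, one less than c.\<close>

lemma even_outside:
  assumes n: "n \<ge> 2" and s: "s < 2 * n\<^sup>2 + 3 * n - 2" "s \<notin> {0..2 * n}"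
  shows "blocked (2 * n) {0..2 * n} s"
proof -
  have key: "blocked (2 * n) {0..2 * n} s"
    if "y \<le> 2 * n" "a \<le> 2 * n" "b \<le> 2 * n" "a \<noteq> b" "a \<noteq> y" "b \<noteq> y" 
      "s + 2 * n * n + n = 2 * n * y + a + b" for y a b
  proof -
    have d3: "\<Sum>({0..2 * n} - {y, a, b}) + y + a + b = n * (2 * n + 1)"
      "card ({0..2 * n} - {y, a, b}) = 2 * n - 2"
      using sum_Diff3[of "{0..2 * n}" y a b] that by (simp_all add: sum_atMost_even)
    have "(2 * n - 1) * y + y = 2 * n * y" using n by (simp add: algebra_simps)
    then have "s + \<Sum>({0..2 * n} - {y, a, b}) = (2 * n - 1) * y"
      using d3(1) that(7) by (simp add: algebra_simps)
    moreover have "2 * n < s" using s(2) by simp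
    ultimately show ?thesis
      using that(1) d3(2) by (intro blockedI[of y _ _ "{0..2 * n} - {y, a, b}"]) auto
  qed
  \<comment> \<open>With y = n + j the equation becomes s + n = 2 n j + v for v = a + b. Dividing s
    - 1 instead of s keeps v at least n + 1, and j is capped because y is at most 2 n.\<close>
  define j where "j = min ((s - 1) div (2 * n)) n"
  define v where "v = s + n - 2 * n * j"
  have jle: "2 * n * j \<le> s - 1"
    unfolding j_def by (metis min.cobounded1 mult_le_mono2 order_trans times_div_less_eq_dividend)
  have j1: "1 \<le> j" using s n unfolding j_def by (simp add: Suc_le_eq div_greater_zero_iff)
  have eq: "s + n = 2 * n * j + v" "n + 1 \<le> v"
    using jle s(2) unfolding v_def by auto
  have jn: "j \<le> n" unfolding j_def by simp
  show ?thesis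
  proof (cases "j = n")
    case True
    have v: "v \<le> 4 * n - 3"
      using eq s(1) True n by (simp add: power2_eq_square)
    have e: "s + 2 * n * n + n = 2 * n * (2 * n) + v" using eq True by simp
    show ?thesis
    proof (cases "v < 2 * n")
      case True
      then show ?thesis using key[of "2 * n" 0 v] e eq(2) by auto
    next
      case False
      then show ?thesis using key[of "2 * n" "2 * n - 1" "v - (2 * n - 1)"] e v n by auto
    qed
  next
    case False
    then have j: "(s - 1) div (2 * n) = j" unfolding j_def by simp
    have "s - 1 < 2 * n + 2 * n * ((s - 1) div (2 * n))"
      using n by (intro dividend_less_times_div) simp
    then have "s - 1 < 2 * n * j + 2 * n" unfolding j by linarith
    then have v: "v \<le> 3 * n" using eq by linarith
    have e: "s + 2 * n * n + n = 2 * n * (n + j) + v" using eq by (simp add: algebra_simps)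
    have "j < n" using False jn by simp
    consider "v \<le> 2 * n" "v \<noteq> n + j" | "v \<le> 2 * n" "v = n + j" | "v > 2 * n" by linarith
    then show ?thesis
    proof cases
      case 1
      then show ?thesis using key[of "n + j" 0 v] e \<open>j < n\<close> eq(2) n by auto
    next
      \<comment> \<open>The pair 0, v would repeat the mean.\<close>
      case 2
      then show ?thesis using key[of "n + j" 1 "v - 1"] e \<open>j < n\<close> j1 n by auto
    next
      case 3
      then show ?thesis using key[of "n + j" "2 * n" "v - 2 * n"] e \<open>j < n\<close> j1 v by auto
    qed
  qed
qed

text \<open>The mean n always works: \<open>W\<close> omits three elements with sum s + 2 n, and s +
  (2 n^2 + n) - (s + 2 n) = (2 n - 1) n. The mean may belong to \<open>W\<close>.\<close>

lemma even_inside: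
  assumes n: "n \<ge> 2" and s: "s \<in> {0..2 * n}"
  shows "\<exists>y W. y \<in> {0..2 * n} \<and> W \<subseteq> {0..2 * n} \<and> card W = 2 * n - 2 \<and> s + \<Sum>W = (2 * n - 1) * y"
proof -
  obtain a b d where abd: "a \<le> 2 * n" "b \<le> 2 * n" "d \<le> 2 * n" "a \<noteq> b" "a \<noteq> d" "b \<noteq> d"
    "a + b + d = s + 2 * n"
  proof (cases "s \<ge> 3")
    case True
    then show ?thesis using that[of 0 "s" "2 * n"] that[of 1 "2 * n - 1" "2 * n"] s n by fastforce
  next
    case False
    then show ?thesis using that[of 0 "s + 1" "2 * n - 1"] n s
      by (cases "s + 1 = 2 * n - 1") (auto intro: that[of 1 2 "2 * n - 1"])
  qed
  have d3: "\<Sum>({0..2 * n} - {a, b, d}) + a + b + d = n * (2 * n + 1)"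
    "card ({0..2 * n} - {a, b, d}) = 2 * n - 2"
    using sum_Diff3[of "{0..2 * n}" a b d] abd by (simp_all add: sum_atMost_even)
  have "(2 * n - 1) * n + n = 2 * n * n" using n by (simp add: algebra_simps)
  then have "s + \<Sum>({0..2 * n} - {a, b, d}) = (2 * n - 1) * n"
    using d3(1) abd(7) by (simp add: algebra_simps)
  then show ?thesis using d3(2) by (intro exI[of _ n] exI[of _ "{0..2 * n} - {a, b, d}"]) auto
qed

lemma range_S_seq_even:
  assumes n: "n \<ge> 2"
  shows "range (S_seq (2 * n)) = base_set (2 * n) (2 * n\<^sup>2 + 3 * n - 2) {0..2 * n}"
proof -
  obtain k where k: "n = k + 2" using n by (metis add.commute le_Suc_ex)
  show ?thesis
  proof (rule range_S_seq_base_set[of _ _ "2 * n"])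
    show "2 * n < 2 * n\<^sup>2 + 3 * n - 2" "(2 * n - 1) * (2 * n) < 2 * (2 * n\<^sup>2 + 3 * n - 2)"
      "2 * (2 * n - 1) * (2 * n) < 2 * (2 * n\<^sup>2 + 3 * n - 2) + (2 * n - 2) * (2 * n - 3)"
      unfolding k by (simp_all add: power2_eq_square algebra_simps)
  qed (use n even_mean_free even_outside even_inside in auto)
qed

section \<open>Odd \<open>m \<ge> 9\<close>\<close>

lemma blocked_mono: "blocked m A b \<Longrightarrow> A \<subseteq> B \<Longrightarrow> blocked m B b"
  unfolding blocked_def by (metis subsetD order_trans)

text \<open>The set {0..2 n} is itself a solution with mean n. Replacing 2 n by 2 n + 1 makes the
  total congruent to 1 modulo 2 n + 1, which destroys it.\<close>

definition odd_N :: "nat \<Rightarrow> nat set" where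
  "odd_N n = {0..2 * n - 1} \<union> {2 * n + 1}"

text \<open>With \<open>d = 2 n\<^sup>2 + 5 n\<close> one has \<open>c = (2 n + 1) d\<close>, so the translates of \<open>odd_N n\<close> in \<open>c T + R\<close> form
  the set \<open>d T + odd_N n\<close>; the numbers \<open>3 n + 1 + c t\<close> are the only other elements.\<close>

definition odd_R :: "nat \<Rightarrow> nat set" where
  "odd_R n = odd_N n \<union> {3 * n + 1} \<union> (+) (2 * n * n + 5 * n) ` odd_N n"

lemma odd_N_iff: "n \<ge> 1 \<Longrightarrow> x \<in> odd_N n \<longleftrightarrow> x < 2 * n \<or> x = 2 * n + 1"
  unfolding odd_N_def by auto

lemma finite_odd_N [simp]: "finite (odd_N n)"
  unfolding odd_N_def by simp

lemma card_odd_N: "n \<ge> 1 \<Longrightarrow> card (odd_N n) = 2 * n + 1"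
  unfolding odd_N_def by (subst card_Un_disjoint) auto

lemma sum_odd_N:
  assumes "n \<ge> 1"
  shows "\<Sum>(odd_N n) = 2 * n * n + n + 1"
proof -
  have "{0..2 * n} = insert (2 * n) {0..2 * n - 1}" using assms by auto
  then have "\<Sum>{0..2 * n} = 2 * n + \<Sum>{0..2 * n - 1}" using assms by simp
  then show ?thesis
    using assms sum_atMost_even[of n] unfolding odd_N_def
    by (subst sum.union_disjoint) (auto simp: algebra_simps)
qed

lemma odd_N_pair:
  assumes "n \<ge> 2" "1 \<le> v" "v \<le> 4 * n"
  shows "\<exists>a\<in>odd_N n. \<exists>b\<in>odd_N n. a \<noteq> b \<and> a + b = v"
proof -
  consider "v < 2 * n" | "v = 2 * n" | "v > 2 * n" by linarith
  then show ?thesis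
  proof cases
    case 1
    then show ?thesis using assms by (intro bexI[of _ 0] bexI[of _ v]) (auto simp: odd_N_iff)
  next
    case 2
    then show ?thesis using assms by (intro bexI[of _ 1] bexI[of _ "v - 1"]) (auto simp: odd_N_iff)
  next
    case 3
    then show ?thesis
      using assms by (intro bexI[of _ "2 * n + 1"] bexI[of _ "v - (2 * n + 1)"]) (auto simp: odd_N_iff)
  qed
qed

text \<open>\<open>W\<close> omits two elements with sum v, so e + 2 n^2 + n + 1 = 2 n y + v. The
  extreme choice y = 2 n + 1, v = 4 n gives e = 2 n^2 + 5 n - 1, which explains the bound on
  e.\<close>

lemma odd_average:
  assumes n: "n \<ge> 2" and e: "e < 2 * n * n + 5 * n"
  shows "\<exists>y W. y \<in> odd_N n \<and> W \<subseteq> odd_N n \<and> card W = 2 * n - 1 \<and> e + \<Sum>W = 2 * n * y"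
proof -
  have key: ?thesis if y: "y \<in> odd_N n" and v: "1 \<le> v" "v \<le> 4 * n"
    and eq: "e + 2 * n * n + n + 1 = 2 * n * y + v" for y v
  proof -
    obtain a b where ab: "a \<in> odd_N n" "b \<in> odd_N n" "a \<noteq> b" "a + b = v"
      using odd_N_pair[OF n v] by blast
    have "\<Sum>(odd_N n - {a, b}) + a + b = 2 * n * n + n + 1" "card (odd_N n - {a, b}) = 2 * n - 1"
      using sum_Diff2[of "odd_N n" a b] ab n by (simp_all add: sum_odd_N card_odd_N)
    then show ?thesis
      using y eq ab(4) by (intro exI[of _ y] exI[of _ "odd_N n - {a, b}"]) auto
  qed
  define j r where "j = (e + n) div (2 * n)" and "r = (e + n) mod (2 * n)"
  have jr: "e + n = 2 * n * j + r" unfolding j_def r_def by simp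
  have r: "r < 2 * n" using n unfolding r_def by simp
  consider "j < n" | "j = n" | "n + 1 \<le> j" by linarith
  then show ?thesis
  proof cases
    case 1
    have "2 * n * (n + j) = 2 * n * n + 2 * n * j" by (simp add: algebra_simps)
    then show ?thesis
      using 1 jr r n by (intro key[of "n + j" "r + 1"]) (simp_all add: odd_N_iff)
  next
    \<comment> \<open>The mean n + j = 2 n is missing from \<open>odd_N n\<close>; 2 n - 1 replaces
      it and v grows by 2 n.\<close>
    case 2
    have "2 * n * (2 * n - 1) + 2 * n = 2 * n * n + 2 * n * n"
      by (cases n) (simp_all add: algebra_simps)
    then show ?thesis
      using key[of "2 * n - 1" "r + 1 + 2 * n"] jr r n 2 by (simp add: odd_N_iff)
  next
    case 3
    then have "2 * n * (n + 1) \<le> 2 * n * j" by (intro mult_le_mono2)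
    then have le: "2 * n * n + 2 * n \<le> e + n" using jr by simp
    have "2 * n * (2 * n + 1) = 2 * n * n + 2 * n * n + 2 * n" by (simp add: algebra_simps)
    then show ?thesis
      using key[of "2 * n + 1" "e + n + 1 - (2 * n * n + 2 * n)"] le e n by (simp add: odd_N_iff)
  qed
qed

text \<open>\<open>W\<close> omits the mean y and one more element a. Since e = 2 n lies below 2 n +
  1, smallness of \<open>W\<close> is a separate hypothesis.\<close>

lemma blocked_odd_N:
  assumes n: "n \<ge> 1" and y: "y \<in> odd_N n" "a \<in> odd_N n" "a \<noteq> y" "y < e"
    and less: "odd_N n - {y, a} \<subseteq> {..<e}"
    and eq: "e + 2 * n * n + n + 1 = (2 * n + 1) * y + a"
  shows "blocked (2 * n + 1) (odd_N n) e"
proof -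
  have "\<Sum>(odd_N n - {y, a}) + y + a = 2 * n * n + n + 1" "card (odd_N n - {y, a}) = 2 * n - 1"
    using sum_Diff2[of "odd_N n" y a] y n by (simp_all add: sum_odd_N card_odd_N)
  then show ?thesis
    using y less eq n by (intro blockedI[of y _ _ "odd_N n - {y, a}"]) auto
qed

lemma blocked_odd_N_insert:
  assumes n: "n \<ge> 1" and y: "y \<in> odd_N n" "a \<in> odd_N n" "b \<in> odd_N n" "a \<noteq> y" "b \<noteq> y" "a \<noteq> b"
    and e: "3 * n + 1 < e"
    and eq: "e + 2 * n * n + n + 1 + (3 * n + 1) = (2 * n + 1) * y + a + b"
  shows "blocked (2 * n + 1) (insert (3 * n + 1) (odd_N n)) e"
proof -
  let ?W = "odd_N n - {y, a, b}"
  have *: "\<Sum>?W + y + a + b = 2 * n * n + n + 1" "card ?W = 2 * n - 2"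
    using sum_Diff3[of "odd_N n" y a b] y n by (simp_all add: sum_odd_N card_odd_N)
  have p: "3 * n + 1 \<notin> odd_N n" using n by (simp add: odd_N_iff)
  have small: "x \<in> odd_N n \<Longrightarrow> x < e" for x using e n by (auto simp: odd_N_iff)
  show ?thesis
  proof (rule blockedI[of y _ _ "insert (3 * n + 1) ?W"])
    show "card (insert (3 * n + 1) ?W) = 2 * n + 1 - 2" using * p n by simp
    show "e + \<Sum>(insert (3 * n + 1) ?W) = (2 * n + 1 - 1) * y" using * p eq by simp
  qed (use y p e small in auto)
qed

text \<open>The means n, n + 1 and 2 n + 1 serve the three ranges. The second ends at 3 n because e
  = 3 n + 1 would omit n + 1, the mean itself. Only \<open>odd_N n\<close> is involved, so the
  result also applies to its translate.\<close>

lemma odd_outside_low: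
  assumes n: "n \<ge> 4" and e: "e = 2 * n \<or> 2 * n + 2 \<le> e \<and> e \<le> 3 * n \<or> 2 * n * n + 3 * n \<le> e"
    "e < 2 * n * n + 5 * n"
  shows "blocked (2 * n + 1) (odd_N n) e"
proof -
  consider "e = 2 * n" | "2 * n + 2 \<le> e" "e \<le> 3 * n" | "2 * n * n + 3 * n \<le> e" "e > 2 * n + 1"
    using e n by fastforce
  then show ?thesis
  proof cases
    case 1
    then show ?thesis
      using n by (intro blocked_odd_N[of n n "2 * n + 1"]) (auto simp: odd_N_iff algebra_simps)
  next
    case 2
    then show ?thesis
      using n by (intro blocked_odd_N[of n "n + 1" "e - 2 * n"]) (auto simp: odd_N_iff algebra_simps)
  next
    case 3
    have "(2 * n + 1) * (2 * n + 1) = 2 * n * n + 2 * n * n + 4 * n + 1" by (simp add: algebra_simps)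
    then show ?thesis
      using n 3 e by (intro blocked_odd_N[of n "2 * n + 1" "e - (2 * n * n + 3 * n)"]) (auto simp: odd_N_iff)
  qed
qed

text \<open>Omitting \<open>a\<close> from \<open>odd_N n\<close> and taking the mean \<open>n + j\<close> reaches \<open>(2 n + 1) j + a - 1\<close>.  This misses
  the values with \<open>a = n + j\<close> or \<open>a = 2 n\<close> and those near the excluded mean \<open>2 n\<close>; for them
  \<open>3 n + 1\<close> serves as an additional summand.\<close>

lemma odd_outside_middle:
  assumes n: "n \<ge> 4" and e: "3 * n + 1 < e" "e < 2 * n * n + 3 * n"
  shows "blocked (2 * n + 1) (insert (3 * n + 1) (odd_N n)) e"
proof -
  define j a where "j = (e + 1) div (2 * n + 1)" and "a = (e + 1) mod (2 * n + 1)"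
  have ja: "e + 1 = (2 * n + 1) * j + a" unfolding j_def a_def by (rule mult_div_mod_eq[symmetric])
  have a: "a \<le> 2 * n" unfolding a_def by (simp flip: less_Suc_eq_le)
  have j1: "1 \<le> j"
    using e n unfolding j_def by (simp add: Suc_le_eq div_greater_zero_iff)
  \<comment> \<open>Where the missing mean 2 n would be called for, the mean is 2 n + 1 with 3 n + 1
    as a summand; the two omitted elements then add up to \<open>v\<close>.\<close>
  have top: ?thesis if "2 * n * n + n \<le> e + 3"
  proof -
    define v where "v = e + 1 - 2 * n * n"
    have v: "v + 2 * n * n = e + 1" "n \<le> v + 2" "v \<le> 3 * n"
      using that e n unfolding v_def by auto
    have sq: "(2 * n + 1) * (2 * n + 1) = 2 * n * n + 2 * n * n + 4 * n + 1" by (simp add: algebra_simps)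
    show ?thesis
    proof (cases "v < 2 * n")
      case True
      then show ?thesis
        using v n e sq by (intro blocked_odd_N_insert[of n "2 * n + 1" 0 v]) (auto simp: odd_N_iff)
    next
      case False
      then show ?thesis
        using v n e sq
        by (intro blocked_odd_N_insert[of n "2 * n + 1" "2 * n - 1" "v - (2 * n - 1)"])
          (auto simp: odd_N_iff)
    qed
  qed
  have jn: "j \<le> n"
  proof (rule ccontr)
    assume "\<not> j \<le> n"
    then have "(2 * n + 1) * (n + 1) \<le> (2 * n + 1) * j" by (intro mult_le_mono2) simp
    then show False using ja e by simp
  qed
  have topj: ?thesis if "(2 * n + 1) * n \<le> (2 * n + 1) * j + a + 2"
  proof -
    have "(2 * n + 1) * n = 2 * n * n + n" by (simp add: algebra_simps)
    then show ?thesis using top that ja by linarith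
  qed
  consider "j = n" | "j < n" "a \<noteq> 2 * n" "a \<noteq> n + j" | "j < n" "a = 2 * n" | "j < n" "a = n + j"
    using jn by linarith
  then show ?thesis
  proof cases
    case 1
    then show ?thesis using topj by simp
  next
    case 2
    have "e + 2 * n * n + n + 1 = (2 * n + 1) * (n + j) + a"
      using ja by (simp add: algebra_simps)
    then have "blocked (2 * n + 1) (odd_N n) e"
      using 2 n e a by (intro blocked_odd_N[of n "n + j" a]) (auto simp: odd_N_iff)
    then show ?thesis by (rule blocked_mono) blast
  next
    case 3
    show ?thesis
    proof (cases "j + 1 = n")
      case True
      then have "(2 * n + 1) * n = (2 * n + 1) * j + 2 * n + 1" by (auto simp: algebra_simps)
      then show ?thesis using topj 3 by simp
    next
      case False
      \<comment> \<open>The mean moves up to n + j + 1; with the summand 3 n + 1 the omitted pair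
        must have sum 3 n.\<close>
      have "e + 2 * n * n + n + 1 + (3 * n + 1) = (2 * n + 1) * (n + j + 1) + (2 * n + 1) + (n - 1)"
        using ja 3 n by (simp add: algebra_simps)
      then show ?thesis
        using 3 False n e
        by (intro blocked_odd_N_insert[of n "n + j + 1" "2 * n + 1" "n - 1"]) (auto simp: odd_N_iff)
    qed
  next
    case 4
    \<comment> \<open>For j = 1 this would be e = 3 n + 1.\<close>
    have j2: "j \<ge> 2"
    proof (rule ccontr)
      assume "\<not> j \<ge> 2"
      then have "j = 1" using j1 by simp
      then show False using ja 4 e by simp
    qed
    show ?thesis
    proof (cases "j + 1 = n")
      case True
      then have "(2 * n + 1) * n = (2 * n + 1) * j + 2 * n + 1" by (auto simp: algebra_simps)
      then show ?thesis using topj 4 True by simp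
    next
      case False
      have "e + 2 * n * n + n + 1 + (3 * n + 1) = (2 * n + 1) * (n + j + 1) + (2 * n + 1) + (j - 1)"
        using ja 4 j2 by (simp add: algebra_simps)
      then show ?thesis
        using 4 False n e j2
        by (intro blocked_odd_N_insert[of n "n + j + 1" "2 * n + 1" "j - 1"]) (auto simp: odd_N_iff)
    qed
  qed
qed

text \<open>The element \<open>3 n + 1\<close> has no translate by \<open>d\<close>.  Its role is taken over by one summand \<open>l\<close> from the
  lower copy of \<open>odd_N n\<close>.\<close>

lemma odd_outside_shifted:
  assumes n: "n \<ge> 4" and e: "3 * n + 1 \<le> e" "e < 2 * n * n + 3 * n"
  shows "blocked (2 * n + 1) (odd_R n) ((2 * n * n + 5 * n) + e)"
proof -
  define d where "d = 2 * n * n + 5 * n"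
  define y \<rho> where "y = (e - (3 * n + 1)) div (2 * n + 1)" and "\<rho> = (e - (3 * n + 1)) mod (2 * n + 1)"
  have "e - (3 * n + 1) = (2 * n + 1) * y + \<rho>" unfolding y_def \<rho>_def
    by (rule mult_div_mod_eq[symmetric])
  then have ey: "e = (2 * n + 1) * y + \<rho> + 3 * n + 1" using e by simp
  have \<rho>: "\<rho> \<le> 2 * n" unfolding \<rho>_def by (simp flip: less_Suc_eq_le)
  have yn: "y < n"
  proof (rule ccontr)
    assume "\<not> y < n"
    then have "(2 * n + 1) * n \<le> (2 * n + 1) * y" by (intro mult_le_mono2) simp
    then show False using ey e by (simp add: algebra_simps)
  qed
  \<comment> \<open>Besides d + e and l the sum has only 2 n - 2 upper terms, so one d is missing
    against 2 n (d + y). Subtracting the total 2 n^2 + n + 1 of \<open>odd_N n\<close> from this d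
    leaves 4 n - 1, the constant of the equation.\<close>
  have key: "blocked (2 * n + 1) (odd_R n) (d + e)"
    if "a \<in> odd_N n" "b \<in> odd_N n" "l \<in> odd_N n" "a \<noteq> b" "a \<noteq> y" "b \<noteq> y"
      "e + l + 1 = 4 * n + (2 * n + 1) * y + a + b" for a b l
  proof -
    let ?U = "odd_N n - {y, a, b}"
    have y: "y \<in> odd_N n" using yn n by (simp add: odd_N_iff)
    have U: "\<Sum>?U + y + a + b = 2 * n * n + n + 1" "card ?U = 2 * n - 2"
      using sum_Diff3[of "odd_N n" y a b] y that n by (simp_all add: sum_odd_N card_odd_N)
    have small: "x < e" "x < d" if "x \<in> odd_N n" for x
      using that e n unfolding d_def by (auto simp: odd_N_iff)
    have l: "l \<notin> (+) d ` ?U" using small(2)[OF that(3)] by auto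
    have "\<Sum>((+) d ` ?U) = (2 * n - 2) * d + \<Sum>?U"
      using U(2) by (simp add: sum.reindex sum.distrib)
    moreover have "(2 * n - 2) * d + 2 * d = 2 * n * d"
      using n by (simp add: algebra_simps)
    ultimately have "(d + e) + (l + \<Sum>((+) d ` ?U)) = 2 * n * (d + y)"
      using U(1) that(7) d_def unfolding distrib_left distrib_right by linarith
    moreover have "card ((+) d ` ?U) = 2 * n - 2" using U(2) by (simp add: card_image)
    ultimately show ?thesis
      using that y l small n unfolding odd_R_def d_def[symmetric]
      by (intro blockedI[of "d + y" _ _ "insert l ((+) d ` ?U)"]) (auto intro: trans_less_add2)
  qed
  \<comment> \<open>The condition is a + b - l = \<rho> + 2 - n. The choice l = 2 n - \<rho>, a + b
    = n + 2 fails only for \<rho> = 0, where l would be the missing 2 n; then l and a + b are raised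
    by one. The element a is 0 unless y = 0.\<close>
  have "\<exists>a b l. a \<in> odd_N n \<and> b \<in> odd_N n \<and> l \<in> odd_N n \<and> a \<noteq> b \<and> a \<noteq> y \<and> b \<noteq> y \<and>
      e + l + 1 = 4 * n + (2 * n + 1) * y + a + b"
  proof (cases "\<rho> = 0"; cases "y = 0")
    assume "\<rho> = 0" "y = 0"
    then show ?thesis
      using ey n by (intro exI[of _ 1] exI[of _ "n + 2"] exI[of _ "2 * n + 1"]) (auto simp: odd_N_iff)
  next
    assume "\<rho> = 0" "y \<noteq> 0"
    then show ?thesis
      using ey n yn by (intro exI[of _ 0] exI[of _ "n + 3"] exI[of _ "2 * n + 1"]) (auto simp: odd_N_iff)
  next
    assume "\<rho> \<noteq> 0" "y = 0"
    then show ?thesis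
      using ey n \<rho> by (intro exI[of _ 1] exI[of _ "n + 1"] exI[of _ "2 * n - \<rho>"]) (auto simp: odd_N_iff)
  next
    assume "\<rho> \<noteq> 0" "y \<noteq> 0"
    then show ?thesis
      using ey n yn \<rho> by (intro exI[of _ 0] exI[of _ "n + 2"] exI[of _ "2 * n - \<rho>"]) (auto simp: odd_N_iff)
  qed
  then show ?thesis using key unfolding d_def by blast
qed

text \<open>Write s = d q + e. The blocks q = 0 and q = 1 contain the two copies of
  \<open>odd_N n\<close>. For q from 2 to 2 n the lifting argument is reused with modulus d and
  residue set \<open>odd_N n\<close>.\<close>

lemma odd_outside:
  assumes n: "n \<ge> 4" and s: "s < (2 * n + 1) * (2 * n * n + 5 * n)" "s \<notin> odd_R n"
  shows "blocked (2 * n + 1) (odd_R n) s"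
proof -
  define d where "d = 2 * n * n + 5 * n"
  have d0: "d > 0" using n unfolding d_def by simp
  define q e where "q = s div d" and "e = s mod d"
  have qe: "s = d * q + e" "e < d" using d0 unfolding q_def e_def by auto
  have "q < 2 * n + 1" using s(1) unfolding q_def d_def[symmetric] by (simp add: less_mult_imp_div_less)
  have R: "odd_R n = odd_N n \<union> {3 * n + 1} \<union> (+) d ` odd_N n" unfolding odd_R_def d_def ..
  have N_less: "odd_N n \<subseteq> {..<d}" using n by (auto simp: odd_N_iff d_def)
  have N_cases: "e = 2 * n \<or> 2 * n + 2 \<le> e" if "e \<notin> odd_N n" using that n by (auto simp: odd_N_iff)
  consider "q = 0" | "q = 1" | "q \<ge> 2" by linarith
  then show ?thesis
  proof cases
    case 1
    then have "s = e" using qe by simp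
    then have "e \<notin> odd_N n" "e \<noteq> 3 * n + 1" using s(2) R by auto
    then consider "e = 2 * n \<or> 2 * n + 2 \<le> e \<and> e \<le> 3 * n \<or> 2 * n * n + 3 * n \<le> e" |
      "3 * n + 1 < e" "e < 2 * n * n + 3 * n"
      using N_cases by linarith
    then show ?thesis
    proof cases
      case 1
      then have "blocked (2 * n + 1) (odd_N n) e"
        using odd_outside_low[OF n] qe(2) unfolding d_def by blast
      then show ?thesis unfolding \<open>s = e\<close> by (rule blocked_mono) (use R in auto)
    next
      case 2
      then have "blocked (2 * n + 1) (insert (3 * n + 1) (odd_N n)) e"
        using odd_outside_middle[OF n] by blast
      then show ?thesis unfolding \<open>s = e\<close> by (rule blocked_mono) (use R in auto)
    qed
  next
    case 2
    then have se: "s = d + e" using qe by simp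
    then have "e \<notin> odd_N n" using s(2) R by auto
    then consider "e = 2 * n \<or> 2 * n + 2 \<le> e \<and> e \<le> 3 * n \<or> 2 * n * n + 3 * n \<le> e" |
      "3 * n + 1 \<le> e" "e < 2 * n * n + 3 * n"
      using N_cases by linarith
    then show ?thesis
    proof cases
      case 1
      then have "blocked (2 * n + 1) (odd_N n) e"
        using odd_outside_low[OF n] qe(2) unfolding d_def by blast
      then show ?thesis unfolding se by (rule blocked_translate[rotated]) (use n R in auto)
    next
      case 2
      then show ?thesis using odd_outside_shifted[OF n] unfolding se d_def by blast
    qed
  next
    case 3
    then have q: "q \<notin> zero_one (2 * n + 1)"
      using zero_one_less[of "2 * n + 1" q] \<open>q < 2 * n + 1\<close> n by auto
    obtain y W where "y \<in> odd_N n" "W \<subseteq> odd_N n" "card W = 2 * n - 1" "e + \<Sum>W = 2 * n * y"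
      using odd_average[of n e] qe(2) n unfolding d_def by auto
    then obtain Y Z where YZ: "Y \<in> base_set (2 * n + 1) d (odd_N n)" "Z \<subseteq> base_set (2 * n + 1) d (odd_N n)"
      "Y < d * q" "Z \<subseteq> {..<d * q}" "Y \<notin> Z" "card Z = 2 * n + 1 - 2"
      "s + \<Sum>Z = (2 * n + 1 - 1) * Y"
      using blocked_lift[of "2 * n + 1" "odd_N n" d q y W e] N_less q n qe(1) by auto
    \<comment> \<open>As q is at most 2 n, only the quotients 0 and 1 occur below d q, and both
      copies lie in \<open>odd_R n\<close>.\<close>
    have sub: "x \<in> odd_R n" if x: "x \<in> base_set (2 * n + 1) d (odd_N n)" "x < d * q" for x
    proof -
      have "x div d < q" using x(2) by (simp add: less_mult_imp_div_less mult.commute)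
      then have "x div d = 0 \<or> x div d = 1"
        using zero_one_less[of "2 * n + 1" "x div d"] base_set_iff[OF N_less] x(1) \<open>q < 2 * n + 1\<close> n
        by auto
      moreover have "x mod d \<in> odd_N n" using base_set_iff[OF N_less] x(1) by blast
      moreover have "d * (x div d) + x mod d = x" by simp
      then have "x = x mod d \<or> x = d + x mod d"
        using calculation(1) by (metis add_0 mult_0_right mult.right_neutral)
      ultimately have "x \<in> odd_N n \<or> x \<in> (+) d ` odd_N n" by (metis imageI)
      then show ?thesis unfolding R by blast
    qed
    show ?thesis
      using YZ sub qe(1) by (intro blockedI[of Y _ _ Z]) (auto 5 0 intro: trans_less_add1)
  qed
qed

text \<open>Within one copy \<open>odd_average\<close> suffices, also for s = 3 n + 1, because it
  treats every e < d.\<close>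

lemma odd_inside:
  assumes n: "n \<ge> 4" and s: "s \<in> odd_R n"
  shows "\<exists>y W. y \<in> odd_R n \<and> W \<subseteq> odd_R n \<and> card W = 2 * n - 1 \<and> s + \<Sum>W = 2 * n * y"
proof -
  define d where "d = 2 * n * n + 5 * n"
  have R: "odd_R n = odd_N n \<union> {3 * n + 1} \<union> (+) d ` odd_N n" unfolding odd_R_def d_def ..
  have N_less: "odd_N n \<subseteq> {..<d}" "3 * n + 1 < d" using n by (auto simp: odd_N_iff d_def)
  show ?thesis
  proof (cases "s < d")
    case True
    then obtain y W where "y \<in> odd_N n" "W \<subseteq> odd_N n" "card W = 2 * n - 1" "s + \<Sum>W = 2 * n * y"
      using odd_average[of n s] n unfolding d_def by auto
    then show ?thesis using R by (intro exI[of _ y] exI[of _ W]) auto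
  next
    case False
    then obtain e where e: "s = d + e" "e \<in> odd_N n" using s N_less R by auto
    then obtain y W where y: "y \<in> odd_N n" "W \<subseteq> odd_N n" "card W = 2 * n - 1" "e + \<Sum>W = 2 * n * y"
      using odd_average[of n e] n N_less unfolding d_def by auto
    have "\<Sum>((+) d ` W) = (2 * n - 1) * d + \<Sum>W"
      using y(3) by (simp add: sum.reindex sum.distrib)
    moreover have "(2 * n - 1) * d + d = 2 * n * d"
      using n by (simp add: diff_mult_distrib)
    ultimately have "s + \<Sum>((+) d ` W) = 2 * n * (d + y)"
      using y(4) unfolding e(1) distrib_left by linarith
    then show ?thesis
      using y R by (intro exI[of _ "d + y"] exI[of _ "(+) d ` W"]) (auto simp: card_image)
  qed
qed

text \<open>\<open>W\<close> and \<open>y\<close> exhaust \<open>odd_N n\<close>, whose total (2 n +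
  1) n + 1 is not divisible by 2 n + 1.\<close>

lemma odd_N_free:
  assumes n: "n \<ge> 1" and W: "W \<subseteq> odd_N n" "y \<in> odd_N n" "y \<notin> W" "card W = 2 * n"
  shows "\<Sum>W \<noteq> 2 * n * y"
proof
  assume eq: "\<Sum>W = 2 * n * y"
  have fin: "finite W" using W(1) by (rule finite_subset) simp
  have "insert y W = odd_N n"
    using W fin n by (intro card_subset_eq) (simp_all add: card_odd_N)
  then have "2 * n * n + n + 1 = y + \<Sum>W"
    using sum_odd_N[OF n] W(3) fin by (metis sum.insert)
  then have "(2 * n + 1) * n + 1 = (2 * n + 1) * y" using eq by simp
  then have "2 * n + 1 dvd (2 * n + 1) * n + 1" by (metis dvd_triv_left)
  then have "2 * n + 1 dvd 1" using dvd_add_right_iff[of "2 * n + 1" "(2 * n + 1) * n" 1] dvd_triv_left by blast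
  then show False using n by simp
qed

text \<open>Exactly one element u is left out, so 2 n^2 + 4 n + 2 = (2 n + 1) y + u. If u is at most
  2 n + 1, the only solution is y = u = n + 1; if u = 3 n + 1, then \<open>odd_N_free\<close>
  applies.\<close>

lemma odd_N_insert_free:
  assumes n: "n \<ge> 3" and W: "W \<subseteq> insert (3 * n + 1) (odd_N n)" "y \<in> odd_N n" "y \<notin> W" "card W = 2 * n"
  shows "\<Sum>W \<noteq> 2 * n * y"
proof
  assume eq: "\<Sum>W = 2 * n * y"
  let ?A = "insert (3 * n + 1) (odd_N n)"
  have fin: "finite W" using W(1) by (rule finite_subset) simp
  have p: "3 * n + 1 \<notin> odd_N n" using n by (simp add: odd_N_iff)
  have A: "card ?A = Suc (card (insert y W))" "\<Sum>?A = 2 * n * n + 4 * n + 2"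
    using p W fin n by (simp_all add: card_odd_N sum_odd_N)
  obtain u where u: "u \<in> ?A" "u \<notin> insert y W" "?A = insert u (insert y W)"
    by (rule subset_card_Suc_obtain[of ?A "insert y W"]) (use W A(1) in auto)
  have "\<Sum>?A = u + (y + \<Sum>W)" unfolding u(3) using u(2) W(3) fin by simp
  then have sum: "2 * n * n + 4 * n + 2 = (2 * n + 1) * y + u" using A(2) eq by simp
  show False
  proof (cases "u = 3 * n + 1")
    case True
    then have "W \<subseteq> odd_N n" using u(2) W(1) by auto
    then show False using odd_N_free[of n W y] W eq n by simp
  next
    case False
    then have uN: "u \<in> odd_N n" using u(1) by auto
    then have u_le: "u \<le> 2 * n + 1" using n by (auto simp: odd_N_iff)
    consider "y \<le> n" | "y = n + 1" | "n + 2 \<le> y" by linarith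
    then show False
    proof cases
      case 1
      then have "(2 * n + 1) * y \<le> (2 * n + 1) * n" by (intro mult_le_mono2)
      then have "(2 * n + 1) * y \<le> 2 * n * n + n" by (simp add: algebra_simps)
      then show False using sum u_le by linarith
    next
      case 2
      then have "(2 * n + 1) * y = 2 * n * n + 3 * n + 1" by (simp add: algebra_simps)
      then show False using sum u(2) 2 by simp
    next
      case 3
      then have "(2 * n + 1) * (n + 2) \<le> (2 * n + 1) * y" by (intro mult_le_mono2)
      then have "2 * n * n + 5 * n + 2 \<le> (2 * n + 1) * y" by (simp add: algebra_simps)
      then show False using sum n by linarith
    qed
  qed
qed

text \<open>Elements are split at d. If \<open>W\<close> has an element on the other side from the
  mean, or the mean is 3 n + 1, a comparison of sizes suffices; the rest is
  \<open>odd_N_free\<close> and \<open>odd_N_insert_free\<close>.\<close>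

lemma odd_mean_free:
  assumes n: "n \<ge> 4"
  shows "\<not> has_mean_solution (2 * n + 1) (odd_R n)"
proof
  define d where "d = 2 * n * n + 5 * n"
  have R: "odd_R n = odd_N n \<union> {3 * n + 1} \<union> (+) d ` odd_N n" unfolding odd_R_def d_def ..
  assume "has_mean_solution (2 * n + 1) (odd_R n)"
  then obtain y W where W: "y \<in> odd_R n" "W \<subseteq> odd_R n" "finite W" "y \<notin> W" "card W = 2 * n"
    and eq: "\<Sum>W = 2 * n * y"
    using has_mean_solution_iff[of "2 * n + 1"] by auto
  have N_le: "x \<le> 2 * n + 1" if "x \<in> odd_N n" for x using that n by (auto simp: odd_N_iff)
  have R_le: "x \<le> d + (2 * n + 1)" if "x \<in> odd_R n" for x using that N_le n unfolding R d_def by fastforce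
  have p_d: "3 * n + 1 < d" "2 * n + 1 < d" using n unfolding d_def by auto
  have low: "x < d \<longleftrightarrow> x \<in> odd_N n \<or> x = 3 * n + 1" if "x \<in> odd_R n" for x
    using that p_d N_le unfolding R by force
  define L U where "L = {x \<in> W. x < d}" and "U = {x \<in> W. d \<le> x}"
  have WLU: "W = L \<union> U" "L \<inter> U = {}" unfolding L_def U_def by auto
  have finLU: "finite L" "finite U" using W(3) unfolding L_def U_def by auto
  have card_LU: "card L + card U = 2 * n" using WLU finLU W(5) card_Un_disjoint by metis
  have sum_LU: "\<Sum>W = \<Sum>L + \<Sum>U" using WLU finLU sum.union_disjoint by metis
  have L: "L \<subseteq> insert (3 * n + 1) (odd_N n)" using W(2) low unfolding L_def by blast
  have U: "U \<subseteq> (+) d ` odd_N n" using W(2) low unfolding U_def R by force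
  have sum_remove1: "\<Sum>W = u + \<Sum>(W - {u})" "card (W - {u}) = 2 * n - 1" if "u \<in> W" for u
    using that W(3,5) by (auto simp: sum.remove)
  have sum_remove2: "\<Sum>W = u + v + \<Sum>(W - {u, v})" "card (W - {u, v}) = 2 * n - 2"
    if "u \<in> W" "v \<in> W" "u \<noteq> v" for u v
    using that sum_Diff2[OF W(3), of u v] W(5) by auto
  show False
  proof (cases "y < d")
    case True
    show False
    proof (cases "U = {}")
      case True
      then have WL: "W = L" using WLU by simp
      show False
      proof (cases "y = 3 * n + 1")
        case True
        then have "W \<subseteq> odd_N n" using L W(4) WL by blast
        then have "\<Sum>W \<le> 2 * n * n + n + 1" using sum_subset_le[of "odd_N n" W] sum_odd_N[of n] n by simp
        moreover have "2 * n * y = 6 * n * n + 2 * n" using True by (simp add: algebra_simps)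
        moreover have "4 * n \<le> n * n" using n by simp
        ultimately show False using eq n by linarith
      next
        case False
        then have "y \<in> odd_N n" using low[OF W(1)] \<open>y < d\<close> by simp
        then show False using odd_N_insert_free[of n W y] L WL W n eq by simp
      qed
    next
      case False
      then obtain u where u: "u \<in> W" "d \<le> u" unfolding U_def by blast
      show False
      proof (cases "y = 3 * n + 1")
        case F: False
        then have "y \<in> odd_N n" using low[OF W(1)] \<open>y < d\<close> by simp
        then have "2 * n * y \<le> 2 * n * (2 * n + 1)" using N_le by (intro mult_le_mono2)
        then have "2 * n * y \<le> 4 * (n * n) + 2 * n" by (simp add: algebra_simps)
        \<comment> \<open>The margin is one: d + (2 n - 1)(n - 1) = 4 n^2 + 2 n + 1.\<close>
        moreover have "(2 * n - 1) * (2 * n - 2) \<le> 2 * \<Sum>(W - {u})"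
          using sum_distinct_nat_ge[of "W - {u}"] sum_remove1(2)[OF u(1)] W(3)
          by (simp add: numeral_2_eq_2)
        moreover have "(2 * n - 1) * (2 * n - 2) + 6 * n = 4 * (n * n) + 2"
        proof -
          obtain k where "n = k + 1" using n that[of "n - 1"] by simp
          then show ?thesis by (simp add: algebra_simps)
        qed
        ultimately show False using sum_remove1(1)[OF u(1)] eq u(2) d_def by (simp add: mult.assoc)
      next
        case True
        then have ny: "2 * n * y = 6 * (n * n) + 2 * n" by (simp add: algebra_simps)
        have nn: "4 * n \<le> n * n" using n by simp
        show False
        \<comment> \<open>For the mean 3 n + 1 a single upper element leaves the sum too small, and
          two make it too large.\<close>
        proof (cases "U = {u}")
          case U1: True
          have "3 * n + 1 \<notin> L" using W(4) True unfolding L_def by blast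
          then have "L \<subseteq> odd_N n" using L by blast
          then have "\<Sum>L \<le> 2 * n * n + n + 1" using sum_subset_le[of "odd_N n" L] sum_odd_N[of n] n by simp
          moreover have "\<Sum>U \<le> d + (2 * n + 1)" using R_le[of u] u(1) W(2) U1 by auto
          ultimately show False using eq sum_LU ny nn n d_def by (simp add: mult.assoc)
        next
          case False
          then obtain v where v: "v \<in> W" "d \<le> v" "u \<noteq> v" using \<open>U \<noteq> {}\<close> u unfolding U_def by blast
          have "(2 * n - 2) * (2 * n - 3) \<le> 2 * \<Sum>(W - {u, v})"
            using sum_distinct_nat_ge[of "W - {u, v}"] sum_remove2(2)[OF u(1) v(1,3)] W(3)
            by (simp add: numeral_3_eq_3 numeral_2_eq_2)
          moreover have "(2 * n - 2) * (2 * n - 3) + 10 * n = 4 * (n * n) + 6"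
          proof -
            obtain k where "n = k + 2" using n that[of "n - 2"] by simp
            then show ?thesis by (simp add: algebra_simps)
          qed
          ultimately show False using sum_remove2(1)[OF u(1) v(1,3)] eq ny u(2) v(2) d_def n
            by (simp add: mult.assoc)
        qed
      qed
    qed
  next
    case False
    then obtain y' where y': "y = d + y'" "y' \<in> odd_N n" using low[OF W(1)] W(1) R by auto
    have ny: "2 * n * y = 2 * n * d + 2 * n * y'" using y'(1) by (simp add: distrib_left)
    define U' where "U' = (\<lambda>x. x - d) ` U"
    have U': "U' \<subseteq> odd_N n" "U = (+) d ` U'" using U unfolding U'_def by (force simp: image_iff)+
    have card_U': "card U' = card U" unfolding U'(2) by (simp add: card_image)
    have sum_U: "\<Sum>U = card U * d + \<Sum>U'"
      unfolding card_U'[symmetric] unfolding U'(2) by (simp add: sum.reindex sum.distrib)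
    have sum_U'_le: "\<Sum>U' \<le> 2 * n * n + n + 1"
      using sum_subset_le[OF _ U'(1)] sum_odd_N[of n] n by simp
    consider "L = {}" | w where "L = {w}" | w v where "w \<in> L" "v \<in> L" "w \<noteq> v" by blast
    then show False
    proof cases
      case 1
      then have "card U' = 2 * n" using card_LU card_U' by simp
      moreover have "y' \<notin> U'" using W(4) WLU(1) 1 y'(1) U'(2) by auto
      ultimately show False
        using odd_N_free[of n U' y'] U'(1) y'(2) n eq sum_LU sum_U ny card_U' 1 by simp
    next
      case 2
      then have cU: "card U = 2 * n - 1" using card_LU by simp
      have "w \<le> 3 * n + 1" using L 2 N_le[of w] by fastforce
      moreover have "(2 * n - 1) * d + d = 2 * n * d" using n by (simp add: diff_mult_distrib)
      ultimately show False
        using eq sum_LU sum_U ny sum_U'_le cU 2 d_def n by simp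
    next
      case 3
      then have wv: "w \<in> W" "v \<in> W" "w \<le> 3 * n + 1" "v \<le> 3 * n + 1"
        using L N_le WLU(1) by fastforce+
      have "\<Sum>(W - {w, v}) \<le> (2 * n - 2) * (d + (2 * n + 1))"
        using sum_bounded_above[of "W - {w, v}" "\<lambda>x. x" "d + (2 * n + 1)"] R_le W(2)
          sum_remove2(2)[OF wv(1,2) 3(3)] by auto
      moreover have "(2 * n - 2) * (d + (2 * n + 1)) + 2 * d + 2 * (2 * n + 1) = 2 * n * d + 2 * n * (2 * n + 1)"
      proof -
        obtain k where "n = k + 1" using n that[of "n - 1"] by simp
        then show ?thesis by (simp add: algebra_simps)
      qed
      moreover have "2 * n * (2 * n + 1) = 4 * n * n + 2 * n" by (simp add: algebra_simps)
      ultimately show False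
        using eq ny sum_remove2(1)[OF wv(1,2) 3(3)] wv(3,4) d_def n by linarith
    qed
  qed
qed

lemma range_S_seq_odd:
  assumes n: "n \<ge> 4"
  shows "range (S_seq (2 * n + 1)) = base_set (2 * n + 1) ((2 * n + 1) * (2 * n * n + 5 * n)) (odd_R n)"
proof -
  obtain k where k: "n = k + 4" using n by (metis add.commute le_Suc_ex)
  show ?thesis
  proof (rule range_S_seq_base_set[of _ _ "2 * n * n + 5 * n + (2 * n + 1)"])
    show "odd_R n \<subseteq> {..2 * n * n + 5 * n + (2 * n + 1)}" "0 \<in> odd_R n"
      using n unfolding odd_R_def by (auto simp: odd_N_iff)
    show "2 * n * n + 5 * n + (2 * n + 1) < (2 * n + 1) * (2 * n * n + 5 * n)"
      "(2 * n + 1 - 1) * (2 * n * n + 5 * n + (2 * n + 1)) < 2 * ((2 * n + 1) * (2 * n * n + 5 * n))"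
      "2 * (2 * n + 1 - 1) * (2 * n * n + 5 * n + (2 * n + 1))
        < 2 * ((2 * n + 1) * (2 * n * n + 5 * n)) + (2 * n + 1 - 2) * (2 * n + 1 - 3)"
      unfolding k by (simp_all add: algebra_simps)
  qed (use n odd_mean_free odd_outside odd_inside in auto)
qed

section \<open>Small \<open>m\<close>\<close>

fun subset_sum :: "nat \<Rightarrow> nat \<Rightarrow> nat list \<Rightarrow> bool" where
  "subset_sum k s [] \<longleftrightarrow> k = 0 \<and> s = 0"
| "subset_sum k s (x # xs) \<longleftrightarrow> s \<le> k * x \<and>
     (0 < k \<and> x \<le> s \<and> subset_sum (k - 1) (s - x) xs \<or> subset_sum k s xs)"

text \<open>A strictly decreasing list has distinct entries, so choosing entries amounts to choosing
  a subset; as the head is the largest entry, the pruning test loses no solution.\<close>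

lemma subset_sum_iff:
  assumes "sorted_wrt (>) xs"
  shows "subset_sum k s xs \<longleftrightarrow> (\<exists>W. W \<subseteq> set xs \<and> card W = k \<and> \<Sum>W = s)"
  using assms
proof (induction xs arbitrary: k s)
  case (Cons x xs)
  have IH: "subset_sum k s xs \<longleftrightarrow> (\<exists>W. W \<subseteq> set xs \<and> card W = k \<and> \<Sum>W = s)" for k s
    using Cons by simp
  have x: "x \<notin> set xs" "\<And>y. y \<in> set xs \<Longrightarrow> y \<le> x" using Cons.prems by auto
  have fin: "finite W" if "W \<subseteq> set (x # xs)" for W
    using that by (rule finite_subset) simp
  have s_le: "s \<le> k * x" if W: "W \<subseteq> set (x # xs)" "card W = k" "\<Sum>W = s" for W
  proof -
    have "i \<le> x" if "i \<in> W" for i using that W(1) x(2) by auto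
    then show ?thesis using sum_bounded_above[of W "\<lambda>i. i" x] W(2,3) by simp
  qed
  show ?case
  proof
    assume "subset_sum k s (x # xs)"
    then consider "0 < k" "x \<le> s" "subset_sum (k - 1) (s - x) xs" | "subset_sum k s xs" by auto
    then show "\<exists>W. W \<subseteq> set (x # xs) \<and> card W = k \<and> \<Sum>W = s"
    proof cases
      case 1
      then obtain W where W: "W \<subseteq> set xs" "card W = k - 1" "\<Sum>W = s - x" using IH by blast
      then have "finite W" "x \<notin> W" using x(1) fin[of W] by auto
      then show ?thesis using W 1 by (intro exI[of _ "insert x W"]) auto
    next
      case 2
      then show ?thesis using IH by (meson set_subset_Cons order_trans)
    qed
  next
    assume "\<exists>W. W \<subseteq> set (x # xs) \<and> card W = k \<and> \<Sum>W = s"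
    then obtain W where W: "W \<subseteq> set (x # xs)" "card W = k" "\<Sum>W = s" by blast
    show "subset_sum k s (x # xs)"
    proof (cases "x \<in> W")
      case True
      have "\<Sum>W = x + \<Sum>(W - {x})" "card W > 0"
        using fin[OF W(1)] True sum.remove[of W x "\<lambda>i. i"] card_gt_0_iff by auto
      moreover have "card (W - {x}) = k - 1" using True fin[OF W(1)] W(2) by simp
      moreover have "W - {x} \<subseteq> set xs" using W(1) by auto
      ultimately have "0 < k" "x \<le> s" "subset_sum (k - 1) (s - x) xs"
        using IH[of "k - 1" "s - x"] W(2,3) by auto
      then show ?thesis using s_le[OF W] by simp
    next
      case False
      then have "W \<subseteq> set xs" using W(1) by auto
      then have "subset_sum k s xs" using IH W(2,3) by blast
      then show ?thesis using s_le[OF W] by simp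
    qed
  qed
qed (auto intro: exI[of _ "{}"])

text \<open>The test \<open>s \<le> k * x\<close> in \<open>subset_sum\<close> prunes the search: \<open>x\<close> is the largest candidate because
  the lists are decreasing.\<close>

definition base_check :: "nat \<Rightarrow> nat \<Rightarrow> nat list \<Rightarrow> bool" where
  "base_check m c xs \<longleftrightarrow> sorted_wrt (>) xs \<and>
     list_all (\<lambda>y. \<not> subset_sum (m - 1) ((m - 1) * y) (filter (\<lambda>x. x \<noteq> y) xs)) xs \<and>
     list_all (\<lambda>s. s \<in> set xs \<or> list_ex (\<lambda>y. y < s \<and> s \<le> (m - 1) * y \<and>
       subset_sum (m - 2) ((m - 1) * y - s) (filter (\<lambda>x. x < s \<and> x \<noteq> y) xs)) xs) [0..<c] \<and>
     list_all (\<lambda>s. list_ex (\<lambda>y. s \<le> (m - 1) * y \<and>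
       subset_sum (m - 2) ((m - 1) * y - s) xs) xs) xs"

lemma range_S_seq_check:
  assumes check: "base_check m c xs" and m: "m \<ge> 3" and xs: "\<forall>x\<in>set xs. x \<le> M" "0 \<in> set xs"
    and c: "M < c" "(m - 1) * M < 2 * c" "2 * (m - 1) * M < 2 * c + (m - 2) * (m - 3)"
  shows "range (S_seq m) = base_set m c (set xs)"
proof (rule range_S_seq_base_set[OF m _ xs(2) c])
  show "set xs \<subseteq> {..M}" using xs(1) by blast
  have sorted: "sorted_wrt (>) xs" using check unfolding base_check_def by blast
  then have iff: "subset_sum k s (filter P xs) \<longleftrightarrow> (\<exists>W. W \<subseteq> {x \<in> set xs. P x} \<and> card W = k \<and> \<Sum>W = s)"
    for k s P
    using subset_sum_iff[OF sorted_wrt_filter] by simp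
  show "\<not> has_mean_solution m (set xs)"
  proof
    assume "has_mean_solution m (set xs)"
    then obtain y W where "y \<in> set xs" "W \<subseteq> set xs" "y \<notin> W" "card W = m - 1" "\<Sum>W = (m - 1) * y"
      using has_mean_solution_iff[of m] m by auto
    moreover from this have "W \<subseteq> {x \<in> set xs. x \<noteq> y}" by blast
    ultimately show False
      using check iff[of "m - 1" "(m - 1) * y" "\<lambda>x. x \<noteq> y"]
      unfolding base_check_def list_all_iff by blast
  qed
  fix s
  {
    assume "s < c" "s \<notin> set xs"
    \<comment> \<open>Recording \<open>s \<le> (m - 1) * y\<close> makes the truncated difference a
      true one.\<close>
    then obtain y where y: "y \<in> set xs" "y < s" "s \<le> (m - 1) * y"
      "subset_sum (m - 2) ((m - 1) * y - s) (filter (\<lambda>x. x < s \<and> x \<noteq> y) xs)"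
      using check unfolding base_check_def list_all_iff list_ex_iff by auto
    then obtain W where W: "W \<subseteq> {x \<in> set xs. x < s \<and> x \<noteq> y}" "card W = m - 2" "\<Sum>W = (m - 1) * y - s"
      unfolding iff by blast
    then show "blocked m (set xs) s"
      using y by (intro blockedI[of y _ _ W]) auto
  next
    assume "s \<in> set xs"
    then obtain y where y: "y \<in> set xs" "s \<le> (m - 1) * y" "subset_sum (m - 2) ((m - 1) * y - s) xs"
      using check unfolding base_check_def list_all_iff list_ex_iff by blast
    then obtain W where "W \<subseteq> set xs" "card W = m - 2" "\<Sum>W = (m - 1) * y - s"
      unfolding subset_sum_iff[OF sorted] by blast
    then show "\<exists>y W. y \<in> set xs \<and> W \<subseteq> set xs \<and> card W = m - 2 \<and> s + \<Sum>W = (m - 1) * y"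
      using y by (intro exI[of _ y] exI[of _ W]) auto
  }
qed

lemma range_S_seq_3: "range (S_seq 3) = base_set 3 1 {0}"
proof -
  have "base_check 3 1 [0]" by code_simp
  from range_S_seq_check[OF this, of 0] show ?thesis by simp
qed

lemma range_S_seq_5: "range (S_seq 5) = base_set 5 122 {0, 1, 2, 3, 5, 7, 13, 26, 27, 28, 29, 31}"
proof -
  let ?xs = "[31, 29, 28, 27, 26, 13, 7, 5, 3, 2, 1, 0]"
  have "base_check 5 122 ?xs" by code_simp
  then have "range (S_seq 5) = base_set 5 122 (set ?xs)"
    by (rule range_S_seq_check[where M = 31]) simp_all
  also have "set ?xs = {0, 1, 2, 3, 5, 7, 13, 26, 27, 28, 29, 31}" by auto
  finally show ?thesis .
qed

lemma range_S_seq_7: "range (S_seq 7) = base_set 7 219 {0, 1, 2, 3, 4, 5, 7, 10, 33, 34, 35, 36, 37, 38}"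
proof -
  let ?xs = "[38, 37, 36, 35, 34, 33, 10, 7, 5, 4, 3, 2, 1, 0]"
  have "base_check 7 219 ?xs" by code_simp
  then have "range (S_seq 7) = base_set 7 219 (set ?xs)"
    by (rule range_S_seq_check[where M = 38]) simp_all
  also have "set ?xs = {0, 1, 2, 3, 4, 5, 7, 10, 33, 34, 35, 36, 37, 38}" by auto
  finally show ?thesis .
qed

section \<open>All m together, in the notation of the theorem\<close>

lemma range_S_seq_eq_base_set:
  assumes m: "m \<ge> 3"
  shows "range (S_seq m) = base_set m (c_val m) (R_set m)"
proof -
  define n where "n = m div 2"
  consider "m = 3" | "m = 5" | "m = 7" | "m = 2 * n" "n \<ge> 2" | "m = 2 * n + 1" "n \<ge> 4"
  proof (cases "even m")
    case True
    then have "m = 2 * n" unfolding n_def by simp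
    then show ?thesis using that m by linarith
  next
    case False
    then have "m = 2 * n + 1" unfolding n_def by simp
    moreover from this have "n = 1 \<or> n = 2 \<or> n = 3 \<or> n \<ge> 4" using m by linarith
    ultimately show ?thesis using that by auto
  qed
  then show ?thesis
  proof cases
    case 1
    then show ?thesis using range_S_seq_3 by (simp add: R_set_def c_val_def)
  next
    case 2
    then show ?thesis using range_S_seq_5 by (simp add: R_set_def c_val_def)
  next
    case 3
    then show ?thesis using range_S_seq_7 by (simp add: R_set_def c_val_def)
  next
    case 4
    then have "m \<noteq> 3" "m \<noteq> 5" "m \<noteq> 7" "even m" by presburger+
    then have "R_set m = {0..2 * n}" "c_val m = 2 * n\<^sup>2 + 3 * n - 2"
      unfolding R_set_def c_val_def n_def[symmetric] Let_def by simp_all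
    then show ?thesis using range_S_seq_even 4 by simp
  next
    case 5
    then have "m \<noteq> 3" "m \<noteq> 5" "m \<noteq> 7" "odd m" by auto
    then have "R_set m = odd_R n" "c_val m = (2 * n + 1) * (2 * n * n + 5 * n)"
      unfolding R_set_def c_val_def n_def[symmetric] Let_def odd_R_def odd_N_def[symmetric]
      by (auto simp: power2_eq_square power3_eq_cube algebra_simps)
    then show ?thesis using range_S_seq_odd 5 by simp
  qed
qed

text \<open>The set of exponents corresponds to the support of the digit function.\<close>

lemma zero_one_iff_digit_function:
  "u \<in> zero_one m \<longleftrightarrow>
    (\<exists>t :: nat \<Rightarrow> nat. (\<forall>i. t i \<in> {0, 1}) \<and> finite {i. t i \<noteq> 0} \<and> u = (\<Sum>i | t i \<noteq> 0. t i * m ^ i))"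
proof
  assume "u \<in> zero_one m"
  then obtain I where "finite I" "u = (\<Sum>i\<in>I. m ^ i)" unfolding zero_one_def by blast
  then show "\<exists>t :: nat \<Rightarrow> nat. (\<forall>i. t i \<in> {0, 1}) \<and> finite {i. t i \<noteq> 0} \<and> u = (\<Sum>i | t i \<noteq> 0. t i * m ^ i)"
    by (intro exI[of _ "\<lambda>i. if i \<in> I then 1 else 0"]) simp
next
  assume "\<exists>t :: nat \<Rightarrow> nat. (\<forall>i. t i \<in> {0, 1}) \<and> finite {i. t i \<noteq> 0} \<and> u = (\<Sum>i | t i \<noteq> 0. t i * m ^ i)"
  then obtain t :: "nat \<Rightarrow> nat" where t: "\<forall>i. t i \<in> {0, 1}" "finite {i. t i \<noteq> 0}"
    "u = (\<Sum>i | t i \<noteq> 0. t i * m ^ i)"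
    by blast
  have "(\<Sum>i | t i \<noteq> 0. t i * m ^ i) = (\<Sum>i | t i \<noteq> 0. m ^ i)"
  proof (rule sum.cong)
    fix i assume "i \<in> {i. t i \<noteq> 0}"
    then have "t i = 1" using spec[OF t(1), of i] by auto
    then show "t i * m ^ i = m ^ i" by simp
  qed simp
  then show "u \<in> zero_one m" using t(2,3) unfolding zero_one_def by blast
qed

theorem theorem4:
  fixes m a :: nat
  assumes "m \<ge> 3"
  shows "a \<in> range (S_seq m) \<longleftrightarrow>
    (\<exists>(t :: nat \<Rightarrow> nat) r. (\<forall>i. t i \<in> {0, 1}) \<and> finite {i. t i \<noteq> 0} \<and> r \<in> R_set m \<and>
       a = c_val m * (\<Sum>i | t i \<noteq> 0. t i * m ^ i) + r)"
  unfolding range_S_seq_eq_base_set[OF assms] base_set_def zero_one_iff_digit_function by blast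

end
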